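(* Let $n\ge 2$. For $c\le 1$ let $u_c(x)=\sqrt{f_c(x_1)^2+|\bar x|^2}$ for $x=(x_1,\bar x)\in\mathbb{R}\times\mathbb{R}^{n-1}=\mathbb{R}^n$, and let $\mathfrak{H}_c\subset\mathbb{R}^{n,1}$ be the graph of $u_c$. Then: (a) For all $c\le 1$, $\mathfrak{H}_c$ is a complete Riemannian manifold with respect to the metric induced from $\mathbb{R}^{n,1}$. (b) For each $c<1$ the principal curvatures of $\mathfrak{H}_c$ are uniformly bounded, while $\mathfrak{H}_1$ has unbounded principal curvatures. (c) $Du_c(\mathbb{R}^n)=B_1(0)$ for all $c<1$, and $Du_1(\mathbb{R}^n)=B_1^+(0):=B_1(0)\cap\{x_1>0\}$.
   Context: $\mathbb{R}^{n,1}$ is $\mathbb{R}^{n+1}$ with the Lorentzian metric $\sum_{i=1}^n dx_i^2-dx_{n+1}^2$. $B_1(0)$ is the open unit ball of $\mathbb{R}^n$. For a graph $x_{n+1}=u(x)$ with $|Du|<1$ the induced metric is $g_{ij}=\delta_{ij}-u_{x_i}u_{x_j}$, the second fundamental form is $h_{ij}=u_{x_ix_j}/\sqrt{1-|Du|^2}$, and the principal curvatures are the eigenvalues of $h$ with respect to $g$. The functions $f_c$: for each real $c\le 1$, $f_c:\mathbb{R}\to(0,\infty)$ is the unique $C^2$ function satisfying on $\mathbb{R}$ the conditions $|f_c'|<1$, $f_c''=f_c^{\,n-1}(1-(f_c')^2)^{\frac{n+2}{2}}$, $(1-(f_c')^2)^{-n/2}-f_c^{\,n}=c$, with the normalization: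 $f_c$ is even if $c<1$; and $f_1(0)=1$, $f_1'(t)>0$ for all $t\in\mathbb{R}$ if $c=1$. (Such functions exist and are uniquely determined by these conditions; e.g. $f_0(t)=\sqrt{1+t^2}$.) The graph $\mathfrak{H}_c$ is spacelike, i.e. $|Du_c|<1$. *)

theory Defs
  imports "HOL-Analysis.Analysis"
begin

definition lorentz :: "'a::real_inner \<times> real \<Rightarrow> 'a \<times> real \<Rightarrow> real" where
  "lorentz v w = fst v \<bullet> fst w - snd v * snd w"

definition graph_of :: "('a \<Rightarrow> 'b) \<Rightarrow> ('a \<times> 'b) set" where
  "graph_of u = range (\<lambda>x. (x, u x))"

definition partial_deriv :: "'n::finite \<Rightarrow> (real ^ 'n \<Rightarrow> real) \<Rightarrow> real ^ 'n \<Rightarrow> real" where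
  "partial_deriv i u x = frechet_derivative u (at x) (axis i 1)"

definition gradient :: "(real ^ 'n::finite \<Rightarrow> real) \<Rightarrow> real ^ 'n \<Rightarrow> real ^ 'n" where
  "gradient u x = (\<chi> i. partial_deriv i u x)"

definition C2_function :: "(real ^ 'n::finite \<Rightarrow> real) \<Rightarrow> bool" where
  "C2_function u \<longleftrightarrow>
     (\<forall>x. u differentiable (at x)) \<and>
     (\<forall>i x. partial_deriv i u differentiable (at x)) \<and>
     (\<forall>i j. continuous_on UNIV (partial_deriv j (partial_deriv i u)))"

definition induced_metric :: "(real ^ 'n::finite \<Rightarrow> real) \<Rightarrow> real ^ 'n \<Rightarrow> real ^ 'n ^ 'n" where
  "induced_metric u x =
     (\<chi> i j. (if i = j then 1 else 0) - partial_deriv i u x * partial_deriv j u x)"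

text \<open>This is the restriction of the Lorentzian form to the coordinate tangent vectors of the graph.\<close>

lemma lorentz_tangent_vectors:
  fixes u :: "real ^ 'n::finite \<Rightarrow> real"
  shows "lorentz (axis i 1 :: real ^ 'n, partial_deriv i u x) (axis j 1, partial_deriv j u x) =
    induced_metric u x $ i $ j"
  by (simp add: lorentz_def induced_metric_def inner_axis_axis)

definition second_fundamental_form ::
  "(real ^ 'n::finite \<Rightarrow> real) \<Rightarrow> real ^ 'n \<Rightarrow> real ^ 'n ^ 'n" where
  "second_fundamental_form u x =
     (\<chi> i j. partial_deriv j (partial_deriv i u) x / sqrt (1 - (norm (gradient u x))\<^sup>2))"

definition principal_curvatures :: "(real ^ 'n::finite \<Rightarrow> real) \<Rightarrow> real ^ 'n \<Rightarrow> real set" where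
  "principal_curvatures u x =
     {\<kappa>. \<exists>v. v \<noteq> 0 \<and>
        second_fundamental_form u x *v v = \<kappa> *\<^sub>R (induced_metric u x *v v)}"

definition speed :: "(real \<Rightarrow> 'a::real_inner \<times> real) \<Rightarrow> real \<Rightarrow> real" where
  "speed \<gamma> t = sqrt (lorentz (vector_derivative \<gamma> (at t)) (vector_derivative \<gamma> (at t)))"

text \<open>
  A \<^const>\<open>valid_path\<close> may have an unbounded derivative near its break points, and the integral of a
  function that is not integrable is 0 by convention.  Integrability of the speed is therefore
  demanded explicitly, so that a curve of infinite length is not counted as one of length 0.
\<close>

definition curves_between ::
  "('a::real_inner \<times> real) set \<Rightarrow> 'a \<times> real \<Rightarrow> 'a \<times> real \<Rightarrow> (real \<Rightarrow> 'a \<times> real) set" where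
  "curves_between M p q =
     {\<gamma>. valid_path \<gamma> \<and> path_image \<gamma> \<subseteq> M \<and> pathstart \<gamma> = p \<and> pathfinish \<gamma> = q \<and>
          speed \<gamma> integrable_on {0..1}}"

definition riemannian_dist ::
  "('a::real_inner \<times> real) set \<Rightarrow> 'a \<times> real \<Rightarrow> 'a \<times> real \<Rightarrow> real" where
  "riemannian_dist M p q =
     (if p \<in> M \<and> q \<in> M
      then INF \<gamma>\<in>curves_between M p q. integral {0..1} (speed \<gamma>) else 0)"

text \<open>
  The constant \<^const>\<open>Metric_space.mcomplete\<close> has its intended meaning only where the
  predicate \<^const>\<open>Metric_space\<close> holds, so both are stated.  That predicate constrains the
  distance also outside the carrier, which is why \<^const>\<open>riemannian_dist\<close> is 0 there.
\<close>

definition complete_riemannian_graph :: "(real ^ 'n::finite \<Rightarrow> real) \<Rightarrow> bool" where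
  "complete_riemannian_graph u \<longleftrightarrow>
     C2_function u \<and>
     (\<forall>x v. v \<noteq> 0 \<longrightarrow> v \<bullet> (induced_metric u x *v v) > 0) \<and>
     Metric_space (graph_of u) (riemannian_dist (graph_of u)) \<and>
     Metric_space.mcomplete (graph_of u) (riemannian_dist (graph_of u))"

text \<open>The conditions that determine the function \<open>f\<^sub>c\<close>, in dimension \<open>n\<close>.\<close>

definition is_profile :: "nat \<Rightarrow> real \<Rightarrow> (real \<Rightarrow> real) \<Rightarrow> bool" where
  "is_profile n c f \<longleftrightarrow>
     (\<forall>t. f t > 0) \<and>
     (\<exists>f' f''.
        (\<forall>t. (f has_real_derivative f' t) (at t)) \<and>
        (\<forall>t. (f' has_real_derivative f'' t) (at t)) \<and>
        continuous_on UNIV f'' \<and>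
        (\<forall>t. \<bar>f' t\<bar> < 1) \<and>
        (\<forall>t. f'' t = f t ^ (n - 1) * (1 - (f' t)\<^sup>2) powr ((real n + 2) / 2)) \<and>
        (\<forall>t. (1 - (f' t)\<^sup>2) powr (- real n / 2) - f t ^ n = c) \<and>
        (c < 1 \<longrightarrow> (\<forall>t. f (- t) = f t)) \<and>
        (c = 1 \<longrightarrow> f 0 = 1 \<and> (\<forall>t. f' t > 0)))"

text \<open>
  The index \<open>k\<close> plays the role of the first coordinate; the sum over the remaining
  indices is the squared norm of the remaining part of \<open>x\<close>.
\<close>

definition rotational_height :: "'n::finite \<Rightarrow> (real \<Rightarrow> real) \<Rightarrow> real ^ 'n \<Rightarrow> real" where
  "rotational_height k f x = sqrt ((f (x $ k))\<^sup>2 + (\<Sum>i\<in>UNIV - {k}. (x $ i)\<^sup>2))"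

end

(*
  With s = sqrt (1 - f'^2), the metric g of the graph and its Hessian satisfy
  D^2 u = (g + (f f'' - s^2) e_1 e_1^T) / u, so the principal curvatures are kappa = 1/(f s) and
  f''/s^3 = (f s)^(n-1).  The first integral reads s^n (c + f^n) = 1, whence
  kappa^n = 1 + c/f^n: both curvatures are bounded if c < 1, and kappa is unbounded if c = 1
  because f then has infimum 0.  Every gradient is obtained by solving one equation for f', so the
  gradient image is governed by the range of f'.

  For completeness, tangent vectors satisfy |v| <= kappa u |v|_g.  Hence ln u is
  Lipschitz along curves on which kappa is bounded, and the Euclidean and the induced length are
  comparable there.  If c = 1, kappa is only bounded on half-spaces x_1 >= T, and curves of bounded
  length stay in such a half-space because x_1 - f(x_1) is 1-Lipschitz for the induced metric.
*)
theory Submission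
  imports Defs
begin

section \<open>Completeness of spacelike graphs\<close>

lemma speed_affine:
  assumes "\<gamma> differentiable (at (m * t + c))" "\<forall>\<^sub>F s in nhds t. \<eta> s = \<gamma> (m * s + c)"
  shows "speed \<eta> t = \<bar>m\<bar> * speed \<gamma> (m * t + c)"
proof -
  let ?D = "vector_derivative \<gamma> (at (m * t + c))"
  have 1: "((\<lambda>s. m * s + c) has_vector_derivative m) (at t)"
    by (auto intro!: derivative_eq_intros simp: has_vector_derivative_def)
  have "((\<lambda>s. \<gamma> (m * s + c)) has_vector_derivative m *\<^sub>R ?D) (at t)"
    using vector_diff_chain_at[OF 1, of \<gamma> ?D] assms(1)
    by (simp add: o_def vector_derivative_works)
  then have "vector_derivative \<eta> (at t) = m *\<^sub>R ?D"
    using vector_derivative_cong_eq[where f = \<eta> and g = "\<lambda>s. \<gamma> (m * s + c)" and A = UNIV and B = UNIV]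
      assms(2) by (simp add: vector_derivative_at)
  then have "speed \<eta> t = sqrt (m\<^sup>2 * lorentz ?D ?D)"
    by (simp add: speed_def lorentz_def power2_eq_square algebra_simps)
  then show ?thesis
    by (simp add: speed_def real_sqrt_mult)
qed

lemma valid_path_differentiable:
  assumes "valid_path \<gamma>"
  obtains S where "finite S" "\<And>t. t \<in> {0..1} - S \<Longrightarrow> \<gamma> differentiable (at t)"
  using assms unfolding valid_path_def piecewise_C1_differentiable_on_def C1_differentiable_on_eq
  by blast

text \<open>One substitution serves reversal (\<open>m = -1\<close>) and both halves of a
  concatenation (\<open>m = 2\<close>). The curves are compared on the open interval only: this
  determines the derivatives there, and no agreement at the junction of joined curves is
  assumed.\<close>

lemma has_integral_speed_affine:
  assumes \<gamma>: "valid_path \<gamma>" "(speed \<gamma> has_integral L) {0..1}" and "m \<noteq> 0"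
    and ab: "(\<lambda>x. x / m - c / m) ` {0..1} = {a..b}"
    and eq: "\<And>t. t \<in> {a<..<b} \<Longrightarrow> \<eta> t = \<gamma> (m * t + c)"
  shows "(speed \<eta> has_integral L) {a..b}"
proof -
  obtain S where S: "finite S" "\<And>t. t \<in> {0..1} - S \<Longrightarrow> \<gamma> differentiable (at t)"
    using valid_path_differentiable[OF \<gamma>(1)] by blast
  have "(\<lambda>x. (1 / m) *\<^sub>R x + - ((1 / m) *\<^sub>R c)) = (\<lambda>x. x / m - c / m)"
    by auto
  then have img: "(\<lambda>x. (1 / m) *\<^sub>R x + - ((1 / m) *\<^sub>R c)) ` cbox 0 1 = {a..b}"
    by (simp only: cbox_interval ab)
  have "((\<lambda>x. speed \<gamma> (m *\<^sub>R x + c)) has_integral (1 / \<bar>m\<bar> ^ DIM(real)) *\<^sub>R L) {a..b}"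
    unfolding img[symmetric] using \<gamma>(2) \<open>m \<noteq> 0\<close>
    by (intro has_integral_affinity) (auto simp only: cbox_interval)
  then have "((\<lambda>x. speed \<gamma> (m * x + c)) has_integral (1 / \<bar>m\<bar>) * L) {a..b}"
    by simp
  from has_integral_mult_right[OF this, of "\<bar>m\<bar>"]
  have *: "((\<lambda>x. \<bar>m\<bar> * speed \<gamma> (m * x + c)) has_integral L) {a..b}"
    using \<open>m \<noteq> 0\<close> by simp
  show ?thesis
  proof (rule has_integral_spike_finite[OF _ _ *])
    \<comment> \<open>Endpoints and preimages of break points do not affect the integral; there are
      finitely many because \<open>m \<noteq> 0\<close> makes the affine map injective.\<close>
    show "finite ({a, b} \<union> (\<lambda>x. m * x + c) -` S)"
      using S(1) \<open>m \<noteq> 0\<close> by (auto intro!: finite_vimageI inj_onI)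
    fix t assume t: "t \<in> {a..b} - ({a, b} \<union> (\<lambda>x. m * x + c) -` S)"
    then have "t \<in> (\<lambda>x. x / m - c / m) ` {0..1}" using ab by simp
    then have "m * t + c \<in> {0..1} - S"
      using t \<open>m \<noteq> 0\<close> by (auto simp: field_simps)
    moreover have "\<forall>\<^sub>F s in nhds t. \<eta> s = \<gamma> (m * s + c)"
      unfolding eventually_nhds using t eq by (intro exI[of _ "{a<..<b}"]) auto
    ultimately show "speed \<eta> t = \<bar>m\<bar> * speed \<gamma> (m * t + c)"
      using S(2) by (intro speed_affine) auto
  qed
qed

lemma has_integral_speed_reversepath:
  assumes "valid_path \<gamma>" "(speed \<gamma> has_integral L) {0..1}"
  shows "(speed (reversepath \<gamma>) has_integral L) {0..1}"
proof (rule has_integral_speed_affine[OF assms, where m = "-1" and c = 1])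
  show "(\<lambda>x::real. x / - 1 - 1 / - 1) ` {0..1} = {0..1}"
    using image_affinity_atLeastAtMost[of "-1" 1 0 1] by simp
qed (auto simp: reversepath_def)

lemma has_integral_speed_joinpaths:
  assumes "valid_path \<gamma>" "(speed \<gamma> has_integral L) {0..1}"
    and "valid_path \<eta>" "(speed \<eta> has_integral K) {0..1}"
  shows "(speed (\<gamma> +++ \<eta>) has_integral (L + K)) {0..1}"
proof (rule has_integral_combine[where c = "1/2"])
  show "(speed (\<gamma> +++ \<eta>) has_integral L) {0..1/2}"
  proof (rule has_integral_speed_affine[OF assms(1,2), where m = 2 and c = 0])
    show "(\<lambda>x::real. x / 2 - 0 / 2) ` {0..1} = {0..1/2}"
      using image_affinity_atLeastAtMost[of "1/2" 0 0 "1::real"] by simp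
  qed (auto simp: joinpaths_def)
  show "(speed (\<gamma> +++ \<eta>) has_integral K) {1/2..1}"
  proof (rule has_integral_speed_affine[OF assms(3,4), where m = 2 and c = "-1"])
    show "(\<lambda>x::real. x / 2 - (-1) / 2) ` {0..1} = {1/2..1}"
      using image_affinity_atLeastAtMost[of "1/2" "1/2" 0 "1::real"] by simp
  qed (auto simp: joinpaths_def)
qed auto

section \<open>The induced norm and lengths of curves on a spacelike graph\<close>

locale spacelike_graph =
  fixes u :: "'a::euclidean_space \<Rightarrow> real" and P :: "'a \<Rightarrow> 'a"
  assumes u_deriv: "(u has_derivative (\<lambda>h. P x \<bullet> h)) (at x)"
    and continuous_P: "continuous_on UNIV P"
    and norm_P: "norm (P x) < 1"
begin

text \<open>This is the Lorentzian length of the tangent vector \<open>(v, P x \<bullet> v)\<close>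
  lying over \<open>v\<close>.\<close>

definition g_norm :: "'a \<Rightarrow> 'a \<Rightarrow> real" where
  "g_norm x v = sqrt ((norm v)\<^sup>2 - (P x \<bullet> v)\<^sup>2)"

lemma inner_P_le: "(P x \<bullet> v)\<^sup>2 \<le> (norm (P x))\<^sup>2 * (norm v)\<^sup>2"
  using Cauchy_Schwarz_ineq[of "P x" v] by (simp add: power2_norm_eq_inner)

lemma norm_sq_le_g: "(1 - (norm (P x))\<^sup>2) * (norm v)\<^sup>2 \<le> (norm v)\<^sup>2 - (P x \<bullet> v)\<^sup>2"
  using inner_P_le[of x v] by (simp add: algebra_simps)

lemma norm_P_sq: "(norm (P x))\<^sup>2 < 1"
  using norm_P[of x] by (simp add: abs_square_less_1)

lemma g_nonneg: "0 \<le> (norm v)\<^sup>2 - (P x \<bullet> v)\<^sup>2"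
  using norm_sq_le_g[of x v] norm_P_sq[of x]
  by (meson diff_ge_0_iff_ge less_imp_le mult_nonneg_nonneg order_trans zero_le_power2)

lemma g_pos: "v \<noteq> 0 \<Longrightarrow> 0 < (norm v)\<^sup>2 - (P x \<bullet> v)\<^sup>2"
  using norm_sq_le_g[of x v] norm_P_sq[of x]
  by (smt (verit, best) mult_pos_pos zero_less_norm_iff zero_less_power2 norm_eq_zero)

lemma g_norm_nonneg: "0 \<le> g_norm x v"
  using g_nonneg[of v x] by (simp add: g_norm_def)

lemma g_norm_le: "g_norm x v \<le> norm v"
  unfolding g_norm_def by (rule real_le_lsqrt) (use g_nonneg[where x = x and v = v] in auto)

lemma norm_le_g_norm: "sqrt (1 - (norm (P x))\<^sup>2) * norm v \<le> g_norm x v"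
  using real_sqrt_le_mono[OF norm_sq_le_g[of x v]] by (simp add: g_norm_def real_sqrt_mult)

text \<open>Near an interior time the vertical component is \<open>u\<close> of the horizontal one,
  so the chain rule and uniqueness of derivatives apply. The endpoints are excluded because the path
  image does not constrain \<gamma> outside the unit interval.\<close>

lemma vector_derivative_graph_curve:
  assumes "\<gamma> differentiable (at t)" "0 < t" "t < 1" "path_image \<gamma> \<subseteq> graph_of u"
  shows "snd (vector_derivative \<gamma> (at t)) = P (fst (\<gamma> t)) \<bullet> fst (vector_derivative \<gamma> (at t))"
proof -
  let ?D = "vector_derivative \<gamma> (at t)"
  have D: "(\<gamma> has_derivative (\<lambda>h. h *\<^sub>R ?D)) (at t)"
    using assms(1) by (simp add: vector_derivative_works has_vector_derivative_def)
  have f: "((\<lambda>t. fst (\<gamma> t)) has_derivative (\<lambda>h. h *\<^sub>R fst ?D)) (at t)"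
    using has_derivative_fst[OF D] by simp
  have s: "((\<lambda>t. snd (\<gamma> t)) has_vector_derivative snd ?D) (at t)"
    using has_derivative_snd[OF D] by (simp add: has_vector_derivative_def)
  have "((\<lambda>t. u (fst (\<gamma> t))) has_vector_derivative P (fst (\<gamma> t)) \<bullet> fst ?D) (at t)"
    (is "(?f has_vector_derivative ?v) _")
    using has_derivative_compose[OF f u_deriv]
    by (simp add: has_vector_derivative_def)
  moreover have eq: "?f s = snd (\<gamma> s)" if "s \<in> {0<..<1}" for s
  proof -
    have "\<gamma> s \<in> graph_of u" using assms(4) that by (auto simp: path_image_def)
    then show ?thesis by (auto simp: graph_of_def)
  qed
  ultimately have "((\<lambda>t. snd (\<gamma> t)) has_vector_derivative P (fst (\<gamma> t)) \<bullet> fst ?D) (at t)"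
    using assms(2,3)
    by (elim has_vector_derivative_transform_within_open[where S = "{0<..<1}"]) simp_all
  then show ?thesis
    using s vector_derivative_unique_at by blast
qed

lemma speed_graph_curve:
  assumes "\<gamma> differentiable (at t)" "0 < t" "t < 1" "path_image \<gamma> \<subseteq> graph_of u"
  shows "speed \<gamma> t = g_norm (fst (\<gamma> t)) (fst (vector_derivative \<gamma> (at t)))"
  using vector_derivative_graph_curve[OF assms]
  by (simp add: speed_def lorentz_def g_norm_def power2_norm_eq_inner flip: power2_eq_square)

text \<open>Integrating the derivative of \<open>F\<close> along the curve turns an infinitesimal
  bound into a bound by length. The bound is required only at points of the curve, so estimates that
  fail elsewhere on the graph can still be used.\<close>

lemma displacement_le_length:
  fixes F :: "'a \<Rightarrow> 'b::euclidean_space"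
  assumes \<gamma>: "\<gamma> \<in> curves_between (graph_of u) p q"
    and F: "\<And>x. (F has_derivative F' x) (at x)"
    and F': "\<And>s v. s \<in> {0..1} \<Longrightarrow> norm (F' (fst (\<gamma> s)) v) \<le> B * g_norm (fst (\<gamma> s)) v"
    and t: "t \<in> {0..1}" and B: "0 \<le> B"
  shows "norm (F (fst (\<gamma> t)) - F (fst p)) \<le> B * integral {0..1} (speed \<gamma>)"
proof -
  have v: "valid_path \<gamma>" and im: "path_image \<gamma> \<subseteq> graph_of u" and p: "\<gamma> 0 = p"
    and int: "speed \<gamma> integrable_on {0..1}"
    using \<gamma> by (auto simp: curves_between_def pathstart_def)
  obtain S where S: "finite S" "\<And>t. t \<in> {0..1} - S \<Longrightarrow> \<gamma> differentiable (at t)"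
    using valid_path_differentiable[OF v] by blast
  define T where "T = {0,1} \<union> S"
  define D where "D s = fst (vector_derivative \<gamma> (at s))" for s
  \<comment> \<open>Both integrands are set to 0 on the finite set \<open>T\<close> of break points
    and endpoints, where the derivative may not exist; this makes the comparison valid at every
    point.\<close>
  define \<phi> where "\<phi> s = (if s \<in> T then 0 else F' (fst (\<gamma> s)) (D s))" for s
  define \<sigma> where "\<sigma> s = (if s \<in> T then 0 else speed \<gamma> s)" for s
  have T: "finite T" using S by (simp add: T_def)
  have good: "\<gamma> differentiable (at s)" "0 < s" "s < 1" if "s \<in> {0..1} - T" for s
    using that S(2) by (auto simp: T_def less_le)
  have speed: "speed \<gamma> s = g_norm (fst (\<gamma> s)) (D s)" if "s \<in> {0..1} - T" for s
    using speed_graph_curve[OF good[OF that] im] by (simp add: D_def)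
  have \<sigma>_nonneg: "0 \<le> \<sigma> s" if "s \<in> {0..1}" for s
    using that speed by (auto simp: \<sigma>_def g_norm_nonneg)
  have "(\<sigma> has_integral integral {0..1} (speed \<gamma>)) {0..1}"
    by (rule has_integral_spike_finite[OF T _ integrable_integral[OF int]]) (auto simp: \<sigma>_def)
  then have int\<sigma>: "\<sigma> integrable_on {0..1}" "integral {0..1} \<sigma> = integral {0..1} (speed \<gamma>)"
    by (auto simp: integral_unique)
  have int\<sigma>t: "\<sigma> integrable_on {0..t}"
    using integrable_on_subinterval[OF int\<sigma>(1)] t by auto
  have der: "((\<lambda>s. F (fst (\<gamma> s))) has_vector_derivative \<phi> s) (at s)" if "s \<in> {0<..<t} - T" for s
  proof -
    have s: "s \<in> {0..1} - T" using that t by auto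
    have D: "(\<gamma> has_derivative (\<lambda>h. h *\<^sub>R vector_derivative \<gamma> (at s))) (at s)"
      using good(1)[OF s] by (simp add: vector_derivative_works has_vector_derivative_def)
    have f: "((\<lambda>t. fst (\<gamma> t)) has_derivative (\<lambda>h. h *\<^sub>R D s)) (at s)"
      using has_derivative_fst[OF D] by (simp add: D_def)
    have "linear (F' (fst (\<gamma> s)))"
      using F has_derivative_linear by blast
    then show ?thesis
      using has_derivative_compose[OF f F] s
      by (simp add: has_vector_derivative_def \<phi>_def linear_cmul)
  qed
  have cF: "continuous_on UNIV F"
    using F by (meson has_derivative_continuous continuous_at_imp_continuous_on)
  have c\<gamma>: "continuous_on {0..1} \<gamma>"
    using v by (simp add: valid_path_def piecewise_C1_differentiable_on_def)
  have "continuous_on {0..1} (\<lambda>s. F (fst (\<gamma> s)))"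
    by (rule continuous_on_compose2[OF cF continuous_on_fst[OF c\<gamma>]]) simp
  then have "continuous_on {0..t} (\<lambda>s. F (fst (\<gamma> s)))"
    by (rule continuous_on_subset) (use t in auto)
  \<comment> \<open>This form of the fundamental theorem allows finitely many exceptional points,
    given continuity of the primitive.\<close>
  then have ftc: "(\<phi> has_integral (F (fst (\<gamma> t)) - F (fst (\<gamma> 0)))) {0..t}"
    using fundamental_theorem_of_calculus_interior_strong[OF T, of 0 t "\<lambda>s. F (fst (\<gamma> s))" \<phi>]
      der t by auto
  have "norm (F (fst (\<gamma> t)) - F (fst p)) = norm (integral {0..t} \<phi>)"
    using ftc p by (simp add: integral_unique)
  also have "\<dots> \<le> integral {0..t} (\<lambda>s. B * \<sigma> s)"
  proof (rule integral_norm_bound_integral)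
    show "\<phi> integrable_on {0..t}" using ftc by blast
    show "(\<lambda>s. B * \<sigma> s) integrable_on {0..t}"
      using integrable_on_cmult_left[OF int\<sigma>t, of B] by simp
    fix s assume "s \<in> {0..t}"
    then have "s \<in> {0..1}" using t by auto
    then show "norm (\<phi> s) \<le> B * \<sigma> s"
      using F' speed by (auto simp: \<phi>_def \<sigma>_def)
  qed
  also have "\<dots> = B * integral {0..t} \<sigma>"
    by simp
  also have "\<dots> \<le> B * integral {0..1} \<sigma>"
    using int\<sigma> int\<sigma>t \<sigma>_nonneg t B
    by (intro mult_left_mono integral_subset_le) auto
  finally show ?thesis by (simp add: int\<sigma>)
qed

text \<open>The displacement bound for the constant map \<open>F = 0\<close> with
  \<open>B = 1\<close> is exactly this inequality.\<close>

lemma length_nonneg: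
  assumes "\<gamma> \<in> curves_between (graph_of u) p q"
  shows "0 \<le> integral {0..1} (speed \<gamma>)"
  using displacement_le_length[OF assms, of "\<lambda>_. 0::real" "\<lambda>_ _. 0" 1 0]
  by (simp add: g_norm_nonneg)

text \<open>The straight segment is lifted to the graph; continuity of \<open>P\<close> makes the
  lift C1, and the induced norm is at most the Euclidean one. It shows both that admissible curves
  exist and that the distance is at most Euclidean.\<close>

lemma segment_curve:
  obtains \<gamma> where "\<gamma> \<in> curves_between (graph_of u) (x, u x) (y, u y)"
    "integral {0..1} (speed \<gamma>) \<le> norm (y - x)"
proof -
  define l where "l t = x + t *\<^sub>R (y - x)" for t
  define \<gamma> where "\<gamma> = (\<lambda>t. (l t, u (l t)))"
  define D where "D t = (y - x, P (l t) \<bullet> (y - x))" for t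
  have l: "(l has_derivative (\<lambda>h. h *\<^sub>R (y - x))) (at t)" for t
    unfolding l_def by (auto intro!: derivative_eq_intros)
  have D: "(\<gamma> has_vector_derivative D t) (at t)" for t
    using has_derivative_Pair[OF l has_derivative_compose[OF l u_deriv]]
    by (simp add: \<gamma>_def D_def has_vector_derivative_def)
  have lc: "continuous_on A l" for A
    unfolding l_def by (intro continuous_intros)
  have Pc: "continuous_on A (\<lambda>t. P (l t))" for A
    by (rule continuous_on_compose2[OF continuous_P lc]) auto
  have "continuous_on {0..1} D"
    unfolding D_def by (intro continuous_intros Pc)
  then have "\<gamma> C1_differentiable_on {0..1}"
    using D by (auto simp: C1_differentiable_on_def)
  then have v: "valid_path \<gamma>"
    by (simp add: valid_path_def C1_differentiable_imp_piecewise)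
  have speed: "speed \<gamma> = (\<lambda>t. g_norm (l t) (y - x))"
    using vector_derivative_at[OF D]
    by (simp add: fun_eq_iff speed_def D_def lorentz_def g_norm_def power2_norm_eq_inner flip: power2_eq_square)
  have int: "speed \<gamma> integrable_on {0..1}"
    unfolding speed g_norm_def by (intro integrable_continuous_real continuous_intros Pc)
  have "integral {0..1} (speed \<gamma>) \<le> integral {0..1::real} (\<lambda>t. norm (y - x))"
    using int by (intro integral_le) (auto simp: speed g_norm_le)
  moreover have "\<gamma> \<in> curves_between (graph_of u) (x, u x) (y, u y)"
    using v int
    by (auto simp: curves_between_def path_image_def graph_of_def pathstart_def pathfinish_def
        \<gamma>_def l_def)
  ultimately show ?thesis using that by auto
qed

section \<open>The induced distance and a criterion for its completeness\<close>

abbreviation "M \<equiv> graph_of u"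
abbreviation "d \<equiv> riemannian_dist (graph_of u)"

lemma curves_between_nonempty: "p \<in> M \<Longrightarrow> q \<in> M \<Longrightarrow> curves_between M p q \<noteq> {}"
proof -
  assume "p \<in> M" "q \<in> M"
  then obtain x y where "p = (x, u x)" "q = (y, u y)"
    by (auto simp: graph_of_def)
  then show ?thesis
    using segment_curve[of x y] by blast
qed

lemma dist_eq: "p \<in> M \<Longrightarrow> q \<in> M \<Longrightarrow> d p q = (INF \<gamma>\<in>curves_between M p q. integral {0..1} (speed \<gamma>))"
  by (simp add: riemannian_dist_def)

lemma dist_nonneg: "0 \<le> d p q"
proof (cases "p \<in> M \<and> q \<in> M")
  case True
  then show ?thesis
    using curves_between_nonempty[of p q] length_nonneg[of _ p q]
    by (simp add: dist_eq cINF_greatest)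
qed (auto simp: riemannian_dist_def)

lemma dist_le_length:
  assumes "\<gamma> \<in> curves_between M p q"
  shows "d p q \<le> integral {0..1} (speed \<gamma>)"
proof -
  have "pathstart \<gamma> \<in> M" "pathfinish \<gamma> \<in> M"
    using assms by (auto simp: curves_between_def)
  then have "p \<in> M" "q \<in> M"
    using assms by (auto simp: curves_between_def)
  then show ?thesis
    unfolding dist_eq[OF \<open>p \<in> M\<close> \<open>q \<in> M\<close>]
    using assms length_nonneg by (intro cINF_lower bdd_belowI2[of _ 0]) auto
qed

lemma dist_less_obtain_curve:
  assumes "p \<in> M" "q \<in> M" "d p q < r"
  obtains \<gamma> where "\<gamma> \<in> curves_between M p q" "integral {0..1} (speed \<gamma>) < r"
  using assms curves_between_nonempty[OF assms(1,2)] length_nonneg[of _ p q]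
  unfolding dist_eq[OF assms(1,2)]
  by (subst (asm) cINF_less_iff) (auto intro!: bdd_belowI2[of _ 0])

lemma dist_le_norm: "d (x, u x) (y, u y) \<le> norm (y - x)"
proof -
  obtain \<gamma> where "\<gamma> \<in> curves_between M (x, u x) (y, u y)" "integral {0..1} (speed \<gamma>) \<le> norm (y - x)"
    by (rule segment_curve)
  then show ?thesis
    using dist_le_length by fastforce
qed

text \<open>The infimum need not be attained, so a curve within \<open>e\<close> of it is reversed;
  the triangle inequality below likewise joins two curves within \<open>e/2\<close>.\<close>

lemma dist_le_reverse:
  assumes "p \<in> M" "q \<in> M"
  shows "d q p \<le> d p q"
proof (rule field_le_epsilon)
  fix e :: real assume "0 < e"
  then obtain \<gamma> where \<gamma>: "\<gamma> \<in> curves_between M p q" "integral {0..1} (speed \<gamma>) < d p q + e"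
    using dist_less_obtain_curve[OF assms, of "d p q + e"] by auto
  then have *: "(speed (reversepath \<gamma>) has_integral integral {0..1} (speed \<gamma>)) {0..1}"
    by (intro has_integral_speed_reversepath) (auto simp: curves_between_def)
  then have "reversepath \<gamma> \<in> curves_between M q p"
    using \<gamma>(1) by (auto simp: curves_between_def)
  from dist_le_length[OF this] show "d q p \<le> d p q + e"
    using \<gamma>(2) integral_unique[OF *] by simp
qed

text \<open>Off the graph both sides are 0 by convention, which gives the symmetry for all points,
  as a metric space demands.\<close>

lemma dist_commute_M: "d p q = d q p"
  using dist_le_reverse[of p q] dist_le_reverse[of q p]
  by (cases "p \<in> M \<and> q \<in> M") (auto simp: riemannian_dist_def)

lemma dist_triangle_M:
  assumes "p \<in> M" "q \<in> M" "r \<in> M"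
  shows "d p r \<le> d p q + d q r"
proof (rule field_le_epsilon)
  fix e :: real assume e: "0 < e"
  obtain \<gamma> where \<gamma>: "\<gamma> \<in> curves_between M p q" "integral {0..1} (speed \<gamma>) < d p q + e/2"
    using dist_less_obtain_curve[OF assms(1,2), of "d p q + e/2"] e by auto
  obtain \<eta> where \<eta>: "\<eta> \<in> curves_between M q r" "integral {0..1} (speed \<eta>) < d q r + e/2"
    using dist_less_obtain_curve[OF assms(2,3), of "d q r + e/2"] e by auto
  have *: "(speed (\<gamma> +++ \<eta>) has_integral integral {0..1} (speed \<gamma>) + integral {0..1} (speed \<eta>)) {0..1}"
    using \<gamma>(1) \<eta>(1) by (intro has_integral_speed_joinpaths) (auto simp: curves_between_def)
  then have "\<gamma> +++ \<eta> \<in> curves_between M p r"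
    using \<gamma>(1) \<eta>(1) by (auto simp: curves_between_def path_image_join intro: valid_path_join)
  from dist_le_length[OF this] show "d p r \<le> d p q + d q r + e"
    using \<gamma>(2) \<eta>(2) integral_unique[OF *] by simp
qed

text \<open>Coercivity makes the base points of a Cauchy sequence bounded in Euclidean space; a
  subsequence converges there, and \<open>dist_le_norm\<close> carries the convergence back to the
  graph. The same estimate separates distinct points.\<close>

lemma complete_if_coercive:
  assumes coercive: "\<And>x R. \<exists>C. \<forall>y. \<forall>\<gamma>\<in>curves_between M (x, u x) (y, u y).
      integral {0..1} (speed \<gamma>) \<le> R \<longrightarrow> norm (y - x) \<le> C * integral {0..1} (speed \<gamma>)"
  shows "Metric_space M d" "Metric_space.mcomplete M d"
proof -
  have lower: "\<exists>C>0. \<forall>y. d (x, u x) (y, u y) < R \<longrightarrow> norm (y - x) \<le> C * d (x, u x) (y, u y)" for x R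
  proof -
    obtain C where C: "\<And>y \<gamma>. \<gamma> \<in> curves_between M (x, u x) (y, u y) \<Longrightarrow> integral {0..1} (speed \<gamma>) \<le> R
        \<Longrightarrow> norm (y - x) \<le> C * integral {0..1} (speed \<gamma>)"
      using coercive by blast
    \<comment> \<open>The bound passes from curves to the infimum: a failure would provide a curve
      of length below \<open>z * norm (y - x) / max C 1\<close>, contradicting the choice of
      \<open>C\<close>. The maximum with 1 makes the divisor positive.\<close>
    have "norm (y - x) \<le> max C 1 * d (x, u x) (y, u y)" if R: "d (x, u x) (y, u y) < R" for y
    proof (rule field_le_mult_one_interval, rule ccontr)
      fix z :: real assume z: "0 < z" "z < 1"
        and "\<not> z * norm (y - x) \<le> max C 1 * d (x, u x) (y, u y)"
      then have *: "d (x, u x) (y, u y) < z * norm (y - x) / max C 1"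
        by (simp add: field_simps)
      obtain \<gamma> where \<gamma>: "\<gamma> \<in> curves_between M (x, u x) (y, u y)"
        "integral {0..1} (speed \<gamma>) < min R (z * norm (y - x) / max C 1)"
        using dist_less_obtain_curve[of "(x, u x)" "(y, u y)" "min R (z * norm (y - x) / max C 1)"] R *
        by (auto simp: graph_of_def)
      have "norm (y - x) \<le> C * integral {0..1} (speed \<gamma>)"
        using C[OF \<gamma>(1)] \<gamma>(2) by auto
      also have "\<dots> \<le> max C 1 * integral {0..1} (speed \<gamma>)"
        using length_nonneg[OF \<gamma>(1)] by (intro mult_right_mono) auto
      also have "\<dots> < z * norm (y - x)"
        using \<gamma>(2) by (simp add: field_simps)
      also have "\<dots> \<le> norm (y - x)"
        using z by (simp add: mult_left_le_one_le)
      finally show False by simp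
    qed
    then show ?thesis
      by (intro exI[of _ "max C 1"]) auto
  qed
  have zero: "p = q" if pq: "p \<in> M" "q \<in> M" "d p q = 0" for p q
  proof -
    obtain x y where xy: "p = (x, u x)" "q = (y, u y)"
      using pq by (auto simp: graph_of_def)
    obtain C where C: "\<forall>y. d (x, u x) (y, u y) < 1 \<longrightarrow> norm (y - x) \<le> C * d (x, u x) (y, u y)"
      using lower by blast
    have "norm (y - x) \<le> 0" using C[rule_format, of y] pq(3) xy by simp
    then show ?thesis using xy by simp
  qed
  have refl: "d p p = 0" if "p \<in> M" for p
    using that dist_nonneg[of p p] dist_le_norm[of "fst p" "fst p"] by (auto simp: graph_of_def)
  show ms: "Metric_space M d"
  proof
    show "d p q = 0 \<longleftrightarrow> p = q" if "p \<in> M" "q \<in> M" for p q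
      using zero[OF that] refl[OF that(1)] by blast
  qed (fact dist_nonneg dist_commute_M dist_triangle_M)+
  interpret Metric_space M d by (rule ms)
  show "mcomplete"
    unfolding mcomplete_def
  proof (intro allI impI)
    fix \<sigma> assume \<sigma>: "MCauchy \<sigma>"
    define x where "x n = fst (\<sigma> n)" for n
    have \<sigma>_eq: "\<sigma> n = (x n, u (x n))" for n
    proof -
      have "\<sigma> n \<in> M" using \<sigma> by (auto simp: MCauchy_def)
      then show ?thesis by (auto simp: graph_of_def x_def)
    qed
    obtain N where N: "\<And>n. n \<ge> N \<Longrightarrow> d (\<sigma> N) (\<sigma> n) < 1"
      using \<sigma> unfolding MCauchy_def by (metis order_refl zero_less_one)
    obtain C where C: "C > 0" "\<And>y. d (\<sigma> N) (y, u y) < 1 \<Longrightarrow> norm (y - x N) \<le> C * d (\<sigma> N) (y, u y)"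
      using lower unfolding \<sigma>_eq by blast
    \<comment> \<open>From \<open>N\<close> on the sequence stays within distance 1 of its term at
      \<open>N\<close>, so the estimate for \<open>R = 1\<close> confines the base points to a ball
      of radius \<open>C\<close>.\<close>
    have bd: "norm (x (n + N) - x N) \<le> C" for n
    proof -
      have "norm (x (n + N) - x N) \<le> C * d (\<sigma> N) (\<sigma> (n + N))"
        using C(2)[of "x (n + N)"] N[of "n + N"] by (simp add: \<sigma>_eq)
      also have "\<dots> \<le> C * 1"
        using N[of "n + N"] C(1) by (intro mult_left_mono) auto
      finally show ?thesis by simp
    qed
    have "bounded (range (\<lambda>n. x (n + N)))"
      unfolding bounded_def using bd by (intro exI[of _ "x N"] exI[of _ C]) (auto simp: dist_norm norm_minus_commute)
    then obtain l r where r: "strict_mono r" "((\<lambda>n. x (n + N)) \<circ> r) \<longlonglongrightarrow> l"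
      using bounded_imp_convergent_subsequence by blast
    define \<rho> where "\<rho> n = r n + N" for n
    have \<rho>: "strict_mono \<rho>" using r(1) by (simp add: strict_mono_def \<rho>_def)
    have lim: "(\<lambda>n. norm (l - x (\<rho> n))) \<longlonglongrightarrow> 0"
      using tendsto_norm_zero[OF LIM_zero[OF r(2)]] by (simp add: o_def \<rho>_def norm_minus_commute)
    have "limitin mtopology (\<sigma> \<circ> \<rho>) (l, u l) sequentially"
      unfolding limit_metric_sequentially
    proof (intro conjI allI impI)
      show "(l, u l) \<in> M" by (simp add: graph_of_def)
      fix e :: real assume "e > 0"
      then obtain K where K: "\<And>n. n \<ge> K \<Longrightarrow> norm (l - x (\<rho> n)) < e"
        using order_tendstoD(2)[OF lim] unfolding eventually_sequentially by blast
      have "(\<sigma> \<circ> \<rho>) n \<in> M \<and> d ((\<sigma> \<circ> \<rho>) n) (l, u l) < e" if "n \<ge> K" for n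
        using K[OF that] dist_le_norm[of "x (\<rho> n)" l] by (simp add: \<sigma>_eq graph_of_def)
      then show "\<exists>K. \<forall>n\<ge>K. (\<sigma> \<circ> \<rho>) n \<in> M \<and> d ((\<sigma> \<circ> \<rho>) n) (l, u l) < e" by blast
    qed
    then show "\<exists>z. limitin mtopology \<sigma> z sequentially"
      using MCauchy_convergent_subsequence[OF \<sigma> \<rho>] by blast
  qed
qed

end

section \<open>The profile equation\<close>

text \<open>These are the conditions of \<open>is_profile\<close> common to all \<open>c\<close>.
  The normalizations, evenness or \<open>f' > 0\<close>, are explicit hypotheses of the lemmas that
  use them.\<close>

locale rotational_graph =
  fixes k :: "'n::finite" and c :: real and f f' f'' :: "real \<Rightarrow> real"
  assumes card_ge_2: "CARD('n) \<ge> 2"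
    and f_pos: "0 < f t"
    and f_deriv: "(f has_real_derivative f' t) (at t)"
    and f'_deriv: "(f' has_real_derivative f'' t) (at t)"
    and continuous_f'': "continuous_on UNIV f''"
    and f'_bound: "\<bar>f' t\<bar> < 1"
    and ode: "f'' t = f t ^ (CARD('n) - 1) * (1 - (f' t)\<^sup>2) powr ((real CARD('n) + 2) / 2)"
    and first_integral: "(1 - (f' t)\<^sup>2) powr (- real CARD('n) / 2) - f t ^ CARD('n) = c"
begin

section \<open>Convexity, the first integral and curvature bounds\<close>

definition s :: "real \<Rightarrow> real" where "s t = sqrt (1 - (f' t)\<^sup>2)"

lemma f'_sq: "(f' t)\<^sup>2 < 1"
  using f'_bound[of t] by (simp add: abs_square_less_1)

lemma s_pos: "0 < s t"
  using f'_sq[of t] by (simp add: s_def)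

lemma s_le_1: "s t \<le> 1"
  by (simp add: s_def)

lemma s_sq: "(s t)\<^sup>2 = 1 - (f' t)\<^sup>2"
  using f'_sq[of t] by (simp add: s_def)

lemma s_powr: "(1 - (f' t)\<^sup>2) powr (a / 2) = s t powr a"
proof -
  have "(1 - (f' t)\<^sup>2) powr (a / 2) = (s t powr 2) powr (a / 2)"
    using s_sq[of t] s_pos[of t] by (simp add: powr_numeral)
  then show ?thesis by (simp add: powr_powr)
qed

lemma s_power: "s t ^ CARD('n) * (c + f t ^ CARD('n)) = 1"
proof -
  have "c + f t ^ CARD('n) = s t powr (- real CARD('n))"
    using first_integral[of t] s_powr[of t "- real CARD('n)"] by simp
  also have "\<dots> = 1 / s t ^ CARD('n)"
    using s_pos[of t] by (simp add: powr_minus powr_realpow divide_inverse)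
  finally show ?thesis using s_pos[of t] by simp
qed

lemma f''_eq: "f'' t = f t ^ (CARD('n) - 1) * s t ^ (CARD('n) + 2)"
proof -
  have "(1 - (f' t)\<^sup>2) powr ((real CARD('n) + 2) / 2) = s t powr real (CARD('n) + 2)"
    unfolding s_powr by (simp add: add.commute)
  also have "\<dots> = s t ^ (CARD('n) + 2)"
    using s_pos by (rule powr_realpow)
  finally show ?thesis
    by (simp add: ode)
qed

lemma f''_pos: "0 < f'' t"
  using f_pos[of t] s_pos[of t] by (simp add: f''_eq)

lemma f'_strict_mono: "a < b \<Longrightarrow> f' a < f' b"
  using DERIV_pos_imp_increasing[of a b f'] f'_deriv f''_pos by blast

text \<open>Convexity: the chord slope equals \<open>f'\<close> at an intermediate point, and
  \<open>f'\<close> increases because \<open>f'' > 0\<close>.\<close>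

lemma f_tangent_le:
  assumes "a \<le> t" shows "f a + f' a * (t - a) \<le> f t"
proof (cases "a = t")
  case False
  with assms obtain z where z: "a < z" "z < t" "f t - f a = (t - a) * f' z"
    using MVT2[of a t f f'] f_deriv by auto
  then have "(t - a) * f' a \<le> (t - a) * f' z"
    using f'_strict_mono[of a z] assms by (intro mult_left_mono) auto
  then show ?thesis using z(3) by (simp add: algebra_simps)
qed simp

definition \<kappa> :: "real \<Rightarrow> real" where "\<kappa> t = 1 / (f t * s t)"

lemma \<kappa>_pos: "0 < \<kappa> t"
  using f_pos s_pos by (simp add: \<kappa>_def)

text \<open>The first integral gives \<open>c + f^n = 1 / s^n\<close>, and \<open>s \<le> 1\<close>.
  For \<open>c < 1\<close> this keeps \<open>f\<close> away from 0.\<close>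

lemma c_plus_ge_1: "1 \<le> c + f t ^ CARD('n)"
proof -
  have "0 < s t ^ CARD('n)" "s t ^ CARD('n) \<le> 1"
    using s_pos[of t] s_le_1[of t] by (auto intro: power_le_one)
  moreover have "c + f t ^ CARD('n) = 1 / s t ^ CARD('n)"
    using s_power[of t] s_pos[of t] by (simp add: field_simps)
  ultimately show ?thesis by simp
qed

lemma \<kappa>_power: "\<kappa> t ^ CARD('n) = 1 + c / f t ^ CARD('n)"
proof -
  have "s t ^ CARD('n) \<noteq> 0" "f t ^ CARD('n) \<noteq> 0"
    using f_pos[of t] s_pos[of t] by auto
  then show ?thesis
    using s_power[of t] by (simp add: \<kappa>_def power_divide power_mult_distrib field_simps)
qed

text \<open>Either \<open>a < 1 \<le> B\<close>, or \<open>a\<close> is at most its own power.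
  Quantities known through their nth powers are thus bounded without extracting roots.\<close>

lemma le_if_power_le:
  fixes a :: real
  assumes "a ^ CARD('n) \<le> B" "1 \<le> B"
  shows "a \<le> B"
  using assms self_le_power[of a "CARD('n)"] by (cases "1 \<le> a") auto

lemma \<kappa>_le:
  assumes "0 < m" "m \<le> f t"
  shows "\<kappa> t \<le> 1 + \<bar>c\<bar> / m ^ CARD('n)"
proof (rule le_if_power_le)
  have "c / f t ^ CARD('n) \<le> \<bar>c\<bar> / f t ^ CARD('n)"
    using f_pos[of t] by (intro divide_right_mono) auto
  also have "\<dots> \<le> \<bar>c\<bar> / m ^ CARD('n)"
    using assms f_pos[of t] by (intro divide_left_mono power_mono mult_pos_pos) auto
  finally show "\<kappa> t ^ CARD('n) \<le> 1 + \<bar>c\<bar> / m ^ CARD('n)"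
    by (simp add: \<kappa>_power)
qed (use assms in simp)

text \<open>The first integral reads \<open>(f s)^n = 1 - c s^n\<close> with
  \<open>s \<le> 1\<close>. This controls the second principal curvature
  \<open>(f s)^(n-1)\<close>.\<close>

lemma fs_le: "f t * s t \<le> 1 + \<bar>c\<bar>"
proof (rule le_if_power_le)
  have s: "0 \<le> s t ^ CARD('n)" "s t ^ CARD('n) \<le> 1"
    using s_pos[of t] s_le_1[of t] by (auto intro: power_le_one)
  have "(f t * s t) ^ CARD('n) = 1 + - c * s t ^ CARD('n)"
    using s_power[of t] by (simp add: power_mult_distrib algebra_simps)
  moreover have "- c * s t ^ CARD('n) \<le> \<bar>c\<bar> * 1"
    using s by (intro mult_mono) auto
  ultimately show "(f t * s t) ^ CARD('n) \<le> 1 + \<bar>c\<bar>"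
    by simp
qed simp

section \<open>The range of \<open>f'\<close>, and unboundedness of \<kappa> for
  \<open>c = 1\<close>\<close>

lemma f'_exceeds:
  assumes t0: "0 < f' t0" and a: "a < 1"
  shows "\<exists>t. a < f' t"
proof (cases "a \<le> 0")
  case True
  then show ?thesis using t0 by (intro exI[of _ t0]) simp
next
  case False
  \<comment> \<open>\<open>b\<close> is the value of \<open>s\<close> that corresponds to slope
    \<open>a\<close>, so the aim becomes \<open>s t < b\<close>. By the first integral this holds
    once \<open>f t\<close> is large enough.\<close>
  define b where "b = sqrt (1 - a\<^sup>2)"
  have "a\<^sup>2 < 1" using False a by (simp add: abs_square_less_1)
  then have b: "0 < b" "b\<^sup>2 = 1 - a\<^sup>2" by (simp_all add: b_def)
  \<comment> \<open>The term \<open>\<bar>c\<bar>\<close> absorbs \<open>c\<close>, so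
    \<open>f^n > A\<close> yields \<open>c + f^n > 1 / b^n\<close>; the summand 1 ensures
    \<open>f \<le> f^n\<close> where \<open>f > A\<close>.\<close>
  define A where "A = 1 + \<bar>c\<bar> + 1 / b ^ CARD('n)"
  have A: "1 \<le> A" using b by (simp add: A_def)
  \<comment> \<open>At this point the tangent at \<open>t0\<close> has risen by \<open>A\<close>,
    and \<open>f\<close> lies above it.\<close>
  define t where "t = t0 + A / f' t0"
  have t: "t0 \<le> t" using t0 A by (simp add: t_def)
  have "A < f t"
    using f_tangent_le[OF t] t0 f_pos[of t0] by (simp add: t_def)
  then have "A < f t ^ CARD('n)"
    using A self_le_power[of "f t" "CARD('n)"] by simp
  then have "1 / b ^ CARD('n) < c + f t ^ CARD('n)"
    by (simp add: A_def)
  also have "\<dots> = 1 / s t ^ CARD('n)"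
    using s_power[of t] s_pos[of t] by (simp add: field_simps)
  finally have "s t ^ CARD('n) < b ^ CARD('n)"
    using b s_pos[of t] by (simp add: field_simps)
  then have "s t < b"
    using b by (simp add: power_less_imp_less_base)
  then have "(s t)\<^sup>2 < b\<^sup>2"
    using s_pos[of t] by (intro power_strict_mono) auto
  then have "a\<^sup>2 < (f' t)\<^sup>2"
    using b s_sq[of t] by simp
  moreover have "0 < f' t"
    using t t0 f'_strict_mono[of t0 t] by (cases "t0 = t") auto
  ultimately show ?thesis
    using power_less_imp_less_base[of a 2 "f' t"] by auto
qed

lemma f'_becomes_small:
  assumes "0 < a" shows "\<exists>t. f' t < a"
proof (rule ccontr)
  assume "\<not> ?thesis"
  then have le: "a \<le> f' t" for t by (simp add: not_less)
  \<comment> \<open>If the slope were at least \<open>a\<close> everywhere, going left from 0 to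
    this point would lower \<open>f\<close> by at least \<open>f 0 + 1\<close>, making it
    negative.\<close>
  define t where "t = - (f 0 + 1) / a"
  have t: "t \<le> 0" using assms f_pos[of 0] by (simp add: t_def field_simps)
  have "f t + a * (0 - t) \<le> f t + f' t * (0 - t)"
    using le t by (intro add_left_mono mult_right_mono) auto
  also have "\<dots> \<le> f 0" using f_tangent_le[OF t] .
  finally show False
    using assms f_pos[of t] by (simp add: t_def)
qed

lemma f'_intermediate:
  assumes "f' a < y" "y < f' b" shows "y \<in> range f'"
proof -
  have "a < b" using assms f'_strict_mono[of b a] by (cases a b rule: linorder_cases) auto
  moreover have "continuous_on {a..b} f'"
    using f'_deriv by (meson DERIV_continuous continuous_at_imp_continuous_on)
  ultimately show ?thesis
    using IVT'[of f' a y b] assms by auto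
qed

text \<open>The derivative of an even function is odd, so \<open>f' 0 = 0\<close> and
  \<open>f' 1 > 0\<close>. Hence \<open>f'\<close> approaches 1 on the right, and oddness mirrors
  this to -1.\<close>

lemma range_f'_even:
  assumes even: "\<And>t. f (- t) = f t"
  shows "range f' = {-1<..<1}"
proof -
  have odd: "f' (- t) = - f' t" for t
  proof -
    have "((\<lambda>t. f (- t)) has_real_derivative - f' (- t)) (at t)"
      using DERIV_mirror[of f "f' (- t)" t] f_deriv by blast
    then have "(f has_real_derivative - f' (- t)) (at t)"
      by (simp add: even)
    from DERIV_unique[OF this f_deriv] show ?thesis by simp
  qed
  have "f' 0 = 0" using odd[of 0] by simp
  then have "0 < f' 1" using f'_strict_mono[of 0 1] by simp
  then have above: "\<exists>t. y < f' t" if "y < 1" for y using f'_exceeds that by blast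
  have below: "\<exists>t. f' t < y" if y: "-1 < y" for y
  proof -
    obtain t where "- y < f' t" using above[of "- y"] y by auto
    then show ?thesis using odd[of t] by (intro exI[of _ "- t"]) simp
  qed
  show ?thesis
    using above below f'_intermediate f'_bound by (force simp: abs_less_iff)
qed

lemma range_f'_pos:
  assumes "\<And>t. 0 < f' t"
  shows "range f' = {0<..<1}"
proof -
  have "y \<in> range f'" if "0 < y" "y < 1" for y
    using f'_exceeds[OF assms that(2)] f'_becomes_small[OF that(1)] f'_intermediate by blast
  then show ?thesis using assms f'_bound by (force simp: abs_less_iff)
qed

text \<open>A bound on \<kappa> keeps \<open>f^n = 1 / (\<kappa>^n - 1)\<close> away from 0; the
  first integral then keeps \<open>s\<close> away from 1, so \<open>f'\<close> stays away from 0,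
  against \<open>f'_becomes_small\<close>.\<close>

lemma \<kappa>_unbounded:
  assumes c: "c = 1" and f': "\<And>t. 0 < f' t"
  shows "\<exists>t. B < \<kappa> t"
proof (rule ccontr)
  assume "\<not> ?thesis"
  then have le: "\<kappa> t \<le> B" for t by (simp add: not_less)
  have B: "0 < B" using le \<kappa>_pos[of 0] by (meson less_le_trans)
  define e where "e = 1 / B ^ CARD('n)"
  have e: "0 < e" using B by (simp add: e_def)
  \<comment> \<open>Since \<open>s^n = 1 / (1 + f^n)\<close> when \<open>c = 1\<close>, this is the
    largest value of \<open>s\<close> compatible with \<open>f^n \<ge> e\<close>.\<close>
  define \<sigma> where "\<sigma> = root CARD('n) (1 / (1 + e))"
  have \<sigma>: "0 < \<sigma>" "\<sigma> < 1" using e by (simp_all add: \<sigma>_def)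
  have s: "s t \<le> \<sigma>" for t
  proof -
    have pos: "0 < f t ^ CARD('n)" "0 < B ^ CARD('n)" using f_pos B by auto
    have "\<kappa> t ^ CARD('n) \<le> B ^ CARD('n)"
      using le \<kappa>_pos[of t] by (intro power_mono) auto
    then have "1 / f t ^ CARD('n) \<le> B ^ CARD('n)"
      using c by (simp add: \<kappa>_power)
    then have "e \<le> f t ^ CARD('n)"
      using pos by (simp add: e_def field_simps)
    moreover have "s t ^ CARD('n) = 1 / (1 + f t ^ CARD('n))"
      using s_power[of t] c pos by (simp add: field_simps)
    ultimately have "s t ^ CARD('n) \<le> 1 / (1 + e)"
      using pos e by (simp add: frac_le)
    then have "root CARD('n) (s t ^ CARD('n)) \<le> \<sigma>"
      unfolding \<sigma>_def by (intro real_root_le_mono) auto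
    then show ?thesis using s_pos[of t] by (simp add: real_root_power_cancel)
  qed
  have "sqrt (1 - \<sigma>\<^sup>2) > 0"
    using \<sigma> by (simp add: abs_square_less_1)
  then obtain t where t: "f' t < sqrt (1 - \<sigma>\<^sup>2)" using f'_becomes_small by blast
  then have "(f' t)\<^sup>2 < 1 - \<sigma>\<^sup>2"
    using f'[of t] by (metis less_imp_le real_sqrt_less_iff real_sqrt_abs abs_of_pos)
  then have "\<sigma>\<^sup>2 < (s t)\<^sup>2" by (simp add: s_sq)
  then show False using s[of t] s_pos[of t] by (smt (verit) power_mono)
qed

end

section \<open>Geometry of the rotational graph\<close>

lemma norm_sq_sum: "(norm v)\<^sup>2 = (\<Sum>i\<in>UNIV. (v $ i)\<^sup>2)" for v :: "real ^ 'n"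
  by (simp add: power2_norm_eq_inner inner_vec_def flip: power2_eq_square)

text \<open>The metric and the Hessian are both diagonal minus rank one, up to a factor; this
  evaluates one row of such a matrix on \<open>v\<close>.\<close>

lemma sum_diagonal_minus_rank_one:
  fixes v w :: "real ^ 'n"
  shows "(\<Sum>j\<in>UNIV. ((if i = j then e else 0) - p * w $ j) * v $ j) = e * v $ i - p * (w \<bullet> v)"
proof -
  have "(\<Sum>j\<in>UNIV. ((if i = j then e else 0) - p * w $ j) * v $ j)
      = (\<Sum>j\<in>UNIV. (if i = j then e * v $ j else 0) - p * (w $ j * v $ j))"
    by (intro sum.cong) (auto simp: algebra_simps)
  then show ?thesis
    by (simp add: sum_subtractf sum_distrib_left inner_vec_def)
qed

context rotational_graph
begin

section \<open>Gradient and Hessian of the height function\<close>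

definition u :: "real ^ 'n \<Rightarrow> real" where "u = rotational_height k f"

text \<open>\<open>P\<close> is the gradient of \<open>u\<close>, and the Hessian of \<open>u\<close> is \<open>(diag b - P P\<^sup>T) / u\<close>.\<close>

definition a :: "real ^ 'n \<Rightarrow> 'n \<Rightarrow> real" where
  "a x i = (if i = k then f (x $ k) * f' (x $ k) else x $ i)"

definition b :: "real ^ 'n \<Rightarrow> 'n \<Rightarrow> real" where
  "b x i = (if i = k then (f' (x $ k))\<^sup>2 + f (x $ k) * f'' (x $ k) else 1)"

definition P :: "real ^ 'n \<Rightarrow> real ^ 'n" where "P x = (\<chi> i. a x i / u x)"

lemma sum_split_k: "(\<Sum>i\<in>UNIV. h i) = h k + (\<Sum>i\<in>UNIV - {k}. h i)" for h :: "'n \<Rightarrow> real"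
  by (rule sum.remove) auto

lemma u_eq: "u x = sqrt ((f (x $ k))\<^sup>2 + (\<Sum>i\<in>UNIV - {k}. (x $ i)\<^sup>2))"
  by (simp add: u_def rotational_height_def)

lemma u_sq: "(u x)\<^sup>2 = (f (x $ k))\<^sup>2 + (\<Sum>i\<in>UNIV - {k}. (x $ i)\<^sup>2)"
  by (simp add: u_eq sum_nonneg)

lemma u_pos: "0 < u x"
  using f_pos[of "x $ k"] unfolding u_eq
  by (intro real_sqrt_gt_zero add_pos_nonneg sum_nonneg) auto

lemma f_nth_deriv: "((\<lambda>x :: real ^ 'n. f (x $ k)) has_derivative (\<lambda>h. f' (x $ k) * h $ k)) (at x)"
  using DERIV_compose_FDERIV[OF f_deriv, of "\<lambda>x :: real ^ 'n. x $ k" "\<lambda>h. h $ k" x UNIV]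
  by (simp add: bounded_linear_imp_has_derivative bounded_linear_vec_nth mult.commute)

lemma f'_nth_deriv: "((\<lambda>x :: real ^ 'n. f' (x $ k)) has_derivative (\<lambda>h. f'' (x $ k) * h $ k)) (at x)"
  using DERIV_compose_FDERIV[OF f'_deriv, of "\<lambda>x :: real ^ 'n. x $ k" "\<lambda>h. h $ k" x UNIV]
  by (simp add: bounded_linear_imp_has_derivative bounded_linear_vec_nth mult.commute)

lemma nth_deriv: "((\<lambda>x :: real ^ 'n. x $ i) has_derivative (\<lambda>h. h $ i)) (at x)"
  by (simp add: bounded_linear_imp_has_derivative bounded_linear_vec_nth)

lemma P_inner: "P x \<bullet> h = (\<Sum>i\<in>UNIV. a x i * h $ i) / u x"
  by (simp add: inner_vec_def P_def sum_divide_distrib)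

lemma u_deriv: "(u has_derivative (\<lambda>h. P x \<bullet> h)) (at x)"
proof -
  have "((\<lambda>x. (f (x $ k))\<^sup>2 + (\<Sum>i\<in>UNIV - {k}. (x $ i)\<^sup>2)) has_derivative
      (\<lambda>h. 2 * f (x $ k) * (f' (x $ k) * h $ k) + (\<Sum>i\<in>UNIV - {k}. 2 * (x $ i) * h $ i))) (at x)"
    by (auto intro!: derivative_eq_intros f_nth_deriv nth_deriv sum.cong simp: fun_eq_iff)
  moreover have "0 < (f (x $ k))\<^sup>2 + (\<Sum>i\<in>UNIV - {k}. (x $ i)\<^sup>2)"
    using u_pos[of x] by (simp flip: u_sq)
  ultimately have "((\<lambda>x. sqrt ((f (x $ k))\<^sup>2 + (\<Sum>i\<in>UNIV - {k}. (x $ i)\<^sup>2))) has_derivative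
      (\<lambda>h. (2 * f (x $ k) * (f' (x $ k) * h $ k) + (\<Sum>i\<in>UNIV - {k}. 2 * (x $ i) * h $ i))
         * (inverse (u x) / 2))) (at x)"
    unfolding u_eq by (rule has_derivative_real_sqrt[rotated])
  moreover have "(2 * f (x $ k) * (f' (x $ k) * h $ k) + (\<Sum>i\<in>UNIV - {k}. 2 * (x $ i) * h $ i))
         * (inverse (u x) / 2) = P x \<bullet> h" for h :: "real ^ 'n"
  proof -
    have "(\<Sum>i\<in>UNIV - {k}. 2 * (x $ i) * h $ i) = 2 * (\<Sum>i\<in>UNIV - {k}. x $ i * h $ i)"
      by (simp add: sum_distrib_left mult.assoc)
    moreover have "(\<Sum>i\<in>UNIV - {k}. a x i * h $ i) = (\<Sum>i\<in>UNIV - {k}. x $ i * h $ i)"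
      by (intro sum.cong) (auto simp: a_def)
    moreover have "a x k = f (x $ k) * f' (x $ k)" by (simp add: a_def)
    ultimately show ?thesis
      using u_pos[of x] unfolding P_inner sum_split_k by (simp add: field_simps)
  qed
  ultimately show ?thesis
    unfolding u_eq[abs_def] by simp
qed

text \<open>The numerator \<open>a x i\<close> depends on \<open>x $ i\<close> alone, which gives
  the diagonal part; differentiating the denominator \<open>u\<close> gives the rank-one
  part.\<close>

lemma P_deriv:
  "((\<lambda>x. P x $ i) has_derivative (\<lambda>h. (b x i * h $ i - P x $ i * (P x \<bullet> h)) / u x)) (at x)"
proof -
  have "((\<lambda>x. a x i) has_derivative (\<lambda>h. b x i * h $ i)) (at x)"
  proof (cases "i = k")
    case True
    then have "(\<lambda>x. a x i) = (\<lambda>x. f (x $ k) * f' (x $ k))" by (simp add: a_def)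
    then show ?thesis using True
      by (auto intro!: derivative_eq_intros f_nth_deriv f'_nth_deriv
          simp: b_def algebra_simps power2_eq_square)
  next
    case False
    then show ?thesis by (simp add: a_def b_def nth_deriv)
  qed
  then have "((\<lambda>x. a x i / u x) has_derivative
      (\<lambda>h. (b x i * h $ i * u x - a x i * (P x \<bullet> h)) / (u x * u x))) (at x)"
    using u_pos[of x] by (intro has_derivative_divide' u_deriv) auto
  moreover have "(b x i * h $ i * u x - a x i * (P x \<bullet> h)) / (u x * u x)
      = (b x i * h $ i - P x $ i * (P x \<bullet> h)) / u x" for h
    using u_pos[of x] by (simp add: P_def field_simps)
  ultimately show ?thesis by (simp add: P_def)
qed

lemma partial_u: "partial_deriv i u x = P x $ i"
  using frechet_derivative_at[OF u_deriv[of x], symmetric]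
  by (simp add: partial_deriv_def inner_axis)

lemma partial_u_fun: "partial_deriv i u = (\<lambda>x. P x $ i)"
  by (simp add: fun_eq_iff partial_u)

lemma gradient_u: "gradient u = P"
  by (simp add: fun_eq_iff gradient_def partial_u vec_eq_iff)

lemma partial2_u:
  "partial_deriv j (partial_deriv i u) x = ((if i = j then b x i else 0) - P x $ i * P x $ j) / u x"
proof -
  have "axis j 1 $ i = (if i = j then 1 else 0 :: real)" by (simp add: axis_def)
  then show ?thesis
    using frechet_derivative_at[OF P_deriv[of i x], symmetric]
    by (simp add: partial_deriv_def[of j] partial_u_fun inner_axis)
qed

lemma continuous_comp_nth:
  assumes "continuous_on UNIV g" shows "continuous_on UNIV (\<lambda>x :: real ^ 'n. g (x $ i) :: real)"
  by (rule continuous_on_compose2[OF assms]) (auto intro: continuous_intros)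

lemma continuous_P_nth: "continuous_on UNIV (\<lambda>x. P x $ i)"
  using P_deriv by (meson has_derivative_continuous continuous_at_imp_continuous_on)

lemma C2_u: "C2_function u"
  unfolding C2_function_def
proof (intro conjI allI)
  show "u differentiable at x" for x
    using u_deriv differentiable_def by blast
  show "partial_deriv i u differentiable at x" for i x
    unfolding partial_u_fun using P_deriv differentiable_def by blast
  have "continuous_on UNIV f" "continuous_on UNIV f'"
    using f_deriv f'_deriv by (meson DERIV_continuous continuous_at_imp_continuous_on)+
  then have b: "continuous_on UNIV (\<lambda>x. b x i)" for i
    using continuous_f'' unfolding b_def
    by (cases "i = k") (auto intro!: continuous_intros continuous_comp_nth)
  have u: "continuous_on UNIV u"
    using u_deriv by (meson has_derivative_continuous continuous_at_imp_continuous_on)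
  show "continuous_on UNIV (partial_deriv j (partial_deriv i u))" for i j
    unfolding partial2_u[abs_def] using u_pos
    by (cases "i = j") (auto intro!: continuous_intros b u continuous_P_nth simp: less_imp_neq[symmetric])
qed

text \<open>The squared numerators add up to \<open>u^2 - f^2 + f^2 f'^2 = u^2 - (f s)^2\<close>.
  Positivity of \<open>f\<close> and \<open>s\<close> thus makes the graph spacelike.\<close>

lemma one_minus_norm_P_sq: "1 - (norm (P x))\<^sup>2 = (f (x $ k) * s (x $ k) / u x)\<^sup>2"
proof -
  have "(norm (P x))\<^sup>2 = (\<Sum>i\<in>UNIV. (a x i)\<^sup>2) / (u x)\<^sup>2"
    by (simp add: norm_sq_sum P_def sum_divide_distrib power_divide)
  also have "(\<Sum>i\<in>UNIV. (a x i)\<^sup>2) = (u x)\<^sup>2 - (f (x $ k) * s (x $ k))\<^sup>2"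
    by (simp add: sum_split_k a_def u_sq power_mult_distrib s_sq algebra_simps)
  finally show ?thesis
    using u_pos[of x] by (simp add: field_simps power_divide)
qed

lemma norm_P_less_1: "norm (P x) < 1"
proof -
  have "0 < (f (x $ k) * s (x $ k) / u x)\<^sup>2"
    using f_pos[of "x $ k"] s_pos[of "x $ k"] u_pos[of x] by simp
  then have "(norm (P x))\<^sup>2 < 1" using one_minus_norm_P_sq[of x] by linarith
  then show ?thesis by (simp add: abs_square_less_1)
qed

sublocale spacelike_graph u P
proof
  show "continuous_on UNIV P"
    using continuous_P_nth by (rule continuous_on_vec_lambda[of _ "\<lambda>i x. P x $ i", simplified])
qed (fact u_deriv norm_P_less_1)+

section \<open>Metric, second fundamental form and principal curvatures\<close>

lemma sqrt_norm_P: "sqrt (1 - (norm (P x))\<^sup>2) = f (x $ k) * s (x $ k) / u x"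
  using f_pos[of "x $ k"] s_pos[of "x $ k"] u_pos[of x] by (simp add: one_minus_norm_P_sq)

lemma metric_mult: "induced_metric u x *v v = v - (P x \<bullet> v) *\<^sub>R P x"
  by (simp add: vec_eq_iff matrix_vector_mult_def induced_metric_def partial_u
      sum_diagonal_minus_rank_one)

lemma metric_pos: "v \<noteq> 0 \<Longrightarrow> 0 < v \<bullet> (induced_metric u x *v v)"
  using g_pos[of v x]
  by (simp add: metric_mult inner_diff_right inner_commute[of v "P x"] power2_norm_eq_inner
      flip: power2_eq_square)

text \<open>The Hessian carries a factor \<open>1 / u\<close> and the normalizing root is
  \<open>f s / u\<close>; \<open>u\<close> cancels and \<kappa> remains.\<close>

lemma second_fundamental_form_mult:
  "(second_fundamental_form u x *v v) $ i = \<kappa> (x $ k) * (b x i * v $ i - P x $ i * (P x \<bullet> v))"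
proof -
  have "(second_fundamental_form u x *v v) $ i =
      (\<Sum>j\<in>UNIV. ((if i = j then b x i else 0) - P x $ i * P x $ j) * v $ j) * \<kappa> (x $ k)"
    using u_pos[of x]
    by (simp add: second_fundamental_form_def matrix_vector_mult_def partial2_u gradient_u
        sqrt_norm_P \<kappa>_def sum_divide_distrib)
  also have "(\<Sum>j\<in>UNIV. ((if i = j then b x i else 0) - P x $ i * P x $ j) * v $ j)
      = b x i * v $ i - P x $ i * (P x \<bullet> v)"
    by (rule sum_diagonal_minus_rank_one)
  finally show ?thesis by simp
qed

text \<open>Dimension at least 2 provides an axis other than \<open>k\<close>; on it
  \<open>b\<close> is 1, so the second fundamental form is \<kappa> times the metric.\<close>

lemma \<kappa>_in_principal_curvatures: "\<kappa> (x $ k) \<in> principal_curvatures u x"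
proof -
  have "\<not> (UNIV :: 'n set) \<subseteq> {k}"
    using card_mono[of "{k}" "UNIV :: 'n set"] card_ge_2 by auto
  then obtain j where j: "j \<noteq> k" by blast
  have "second_fundamental_form u x *v axis j 1 = \<kappa> (x $ k) *\<^sub>R (induced_metric u x *v axis j 1)"
    using j by (simp add: vec_eq_iff second_fundamental_form_mult metric_mult b_def axis_def)
  then show ?thesis
    unfolding principal_curvatures_def by (auto intro!: exI[of _ "axis j 1"] simp: axis_eq_0_iff)
qed

text \<open>With \<open>q = \<mu> / \<kappa>\<close>, the case \<open>q = 1\<close> is the first
  eigenvalue. Otherwise the components off \<open>k\<close> tie \<open>v\<close> to
  \<open>P x\<close>, and component \<open>k\<close> determines \<mu>.\<close>

lemma principal_curvatures_subset:
  "principal_curvatures u x \<subseteq> {\<kappa> (x $ k), (f (x $ k) * s (x $ k)) ^ (CARD('n) - 1)}"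
proof
  fix \<mu> assume "\<mu> \<in> principal_curvatures u x"
  then obtain v where v: "v \<noteq> 0"
    and eq: "second_fundamental_form u x *v v = \<mu> *\<^sub>R (induced_metric u x *v v)"
    unfolding principal_curvatures_def by blast
  define t p q where "t = x $ k" and "p = P x \<bullet> v" and "q = \<mu> * (f t * s t)"
  have fs: "0 < f t" "0 < s t" "0 < u x" using f_pos s_pos u_pos by auto
  have comp: "b x i * v $ i - P x $ i * p = q * (v $ i - P x $ i * p)" for i
  proof -
    have "\<kappa> t * (b x i * v $ i - P x $ i * p) = \<mu> * (v $ i - P x $ i * p)"
      using eq by (simp add: vec_eq_iff second_fundamental_form_mult metric_mult t_def p_def mult_ac)
    then show ?thesis
      using fs by (simp add: \<kappa>_def q_def field_simps)
  qed
  show "\<mu> \<in> {\<kappa> (x $ k), (f (x $ k) * s (x $ k)) ^ (CARD('n) - 1)}"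
  proof (cases "q = 1")
    case True
    then show ?thesis using fs by (simp add: q_def \<kappa>_def t_def field_simps)
  next
    case False
    \<comment> \<open>Off \<open>k\<close> the equation is
      \<open>(1 - q) (v_i - P_i p) = 0\<close>.\<close>
    have vi: "v $ i = P x $ i * p" if "i \<noteq> k" for i
      using comp[of i] that False by (simp add: b_def)
    have Pk: "P x $ k = f t * f' t / u x" by (simp add: P_def a_def t_def)
    \<comment> \<open>Substituting these components into the definition of \<open>p\<close>
      expresses \<open>p\<close>, and with it all of \<open>v\<close>, through
      \<open>v $ k\<close>.\<close>
    have "p = P x $ k * v $ k + (\<Sum>i\<in>UNIV - {k}. P x $ i * v $ i)"
      by (simp add: p_def inner_vec_def sum_split_k)
    also have "(\<Sum>i\<in>UNIV - {k}. P x $ i * v $ i) = p * (\<Sum>i\<in>UNIV - {k}. (P x $ i)\<^sup>2)"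
      by (simp add: vi sum_distrib_left power2_eq_square mult_ac)
    also have "(\<Sum>i\<in>UNIV - {k}. (P x $ i)\<^sup>2) = ((u x)\<^sup>2 - (f t)\<^sup>2) / (u x)\<^sup>2"
      by (simp add: u_sq P_def a_def power_divide sum_divide_distrib t_def)
    finally have "p * (f t)\<^sup>2 / (u x)\<^sup>2 = P x $ k * v $ k"
      using fs by (simp add: field_simps)
    then have p: "p = u x * f' t * v $ k / f t"
      using fs by (simp add: Pk field_simps power2_eq_square)
    have vk: "v $ k \<noteq> 0"
    proof
      assume "v $ k = 0"
      then have "v $ i = 0" for i using vi p by (cases "i = k") auto
      then show False using v by (simp add: vec_eq_iff)
    qed
    have Pkp: "P x $ k * p = (f' t)\<^sup>2 * v $ k"
      using fs by (simp add: p Pk power2_eq_square)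
    \<comment> \<open>Here \<open>b - f'^2 = f f''\<close> and \<open>1 - f'^2 = s^2\<close>, so
      \<open>q = f f'' / s^2\<close> and \<mu> is \<open>f'' / s^3\<close>.\<close>
    have "b x k * v $ k - (f' t)\<^sup>2 * v $ k = q * (v $ k - (f' t)\<^sup>2 * v $ k)"
      using comp[of k] by (simp only: Pkp)
    then have "f t * f'' t * v $ k = q * (s t)\<^sup>2 * v $ k"
      by (simp add: b_def t_def[symmetric] s_sq algebra_simps)
    then have "f t * f'' t = q * (s t)\<^sup>2" using vk by simp
    then have "f'' t = \<mu> * s t ^ 3"
      using fs by (simp add: q_def power2_eq_square power3_eq_cube)
    moreover have "s t ^ (CARD('n) + 2) = s t ^ (CARD('n) - 1) * s t ^ 3"
      using card_ge_2 by (simp flip: power_add)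
    ultimately have "\<mu> * s t ^ 3 = (f t * s t) ^ (CARD('n) - 1) * s t ^ 3"
      by (auto simp: f''_eq power_mult_distrib)
    then show ?thesis using fs by (simp add: t_def)
  qed
qed

text \<open>The first integral gives \<open>f^n \<ge> 1 - c\<close>, and \<open>f \<ge> f^n\<close>
  where \<open>f < 1\<close>; the minimum with 1 covers the other points.\<close>

lemma f_bounded_below:
  assumes "c < 1"
  obtains m where "0 < m" "\<And>t. m \<le> f t"
proof
  show "0 < min 1 (1 - c)" using assms by simp
  show "min 1 (1 - c) \<le> f t" for t
  proof (cases "1 \<le> f t")
    case False
    then have "f t ^ CARD('n) \<le> f t ^ 1"
      using f_pos[of t] by (intro power_decreasing) auto
    then show ?thesis using c_plus_ge_1[of t] by simp
  qed simp
qed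

lemma principal_curvatures_bounded:
  assumes "c < 1"
  shows "bounded (\<Union>x. principal_curvatures u x)"
proof -
  obtain m where m: "0 < m" and f: "\<And>t. m \<le> f t"
    using f_bounded_below[OF assms] by blast
  have 1: "\<bar>\<kappa> t\<bar> \<le> 1 + \<bar>c\<bar> / m ^ CARD('n)" for t
    using \<kappa>_le[OF m f] \<kappa>_pos[of t] by simp
  have 2: "\<bar>(f t * s t) ^ (CARD('n) - 1)\<bar> \<le> (1 + \<bar>c\<bar>) ^ (CARD('n) - 1)" for t
    using fs_le[of t] f_pos[of t] s_pos[of t] by (simp add: power_mono)
  show ?thesis
    unfolding bounded_iff
    using 1 2 principal_curvatures_subset
    by (intro exI[of _ "max (1 + \<bar>c\<bar> / m ^ CARD('n)) ((1 + \<bar>c\<bar>) ^ (CARD('n) - 1))"])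
      (fastforce simp: le_max_iff_disj)
qed

lemma principal_curvatures_unbounded:
  assumes "c = 1" "\<And>t. 0 < f' t"
  shows "\<not> bounded (\<Union>x. principal_curvatures u x)"
proof
  assume "bounded (\<Union>x. principal_curvatures u x)"
  then obtain B where B: "\<And>x \<mu>. \<mu> \<in> principal_curvatures u x \<Longrightarrow> \<bar>\<mu>\<bar> \<le> B"
    unfolding bounded_iff by auto
  obtain t where "B < \<kappa> t" using \<kappa>_unbounded[OF assms] by blast
  then show False
    using B[OF \<kappa>_in_principal_curvatures[of "axis k t"]] by simp
qed

section \<open>The image of the gradient\<close>

lemma P_k: "P x $ k = f (x $ k) * f' (x $ k) / u x"
  by (simp add: P_def a_def)

text \<open>If \<open>P x = y\<close>, the components off \<open>k\<close> give
  \<open>x_i = u y_i\<close>, whence \<open>u = f / r\<close>, where \<open>r\<close> is the root in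
  the hypothesis. Component \<open>k\<close> then says \<open>r f' = y_k\<close>. So any solution
  \<tau> of this single equation determines a preimage.\<close>

lemma range_P:
  assumes y: "norm y < 1" and \<tau>: "f' \<tau> * sqrt (1 - (\<Sum>i\<in>UNIV - {k}. (y $ i)\<^sup>2)) = y $ k"
  shows "y \<in> range P"
proof -
  define r where "r = sqrt (1 - (\<Sum>i\<in>UNIV - {k}. (y $ i)\<^sup>2))"
  have "(norm y)\<^sup>2 = (y $ k)\<^sup>2 + (\<Sum>i\<in>UNIV - {k}. (y $ i)\<^sup>2)"
    by (simp add: norm_sq_sum sum_split_k)
  moreover have "(norm y)\<^sup>2 < 1" using y by (simp add: abs_square_less_1)
  ultimately have "(\<Sum>i\<in>UNIV - {k}. (y $ i)\<^sup>2) < 1"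
    using zero_le_power2[of "y $ k"] by linarith
  then have r: "0 < r" "(\<Sum>i\<in>UNIV - {k}. (y $ i)\<^sup>2) = 1 - r\<^sup>2"
    by (simp_all add: r_def)
  define x :: "real ^ 'n" where "x = (\<chi> i. if i = k then \<tau> else y $ i * f \<tau> / r)"
  have "(u x)\<^sup>2 = (f \<tau>)\<^sup>2 + (\<Sum>i\<in>UNIV - {k}. (y $ i)\<^sup>2) * ((f \<tau>)\<^sup>2 / r\<^sup>2)"
    by (simp add: u_sq x_def sum_distrib_right sum_divide_distrib power_divide power_mult_distrib)
  also have "\<dots> = (f \<tau> / r)\<^sup>2"
    using r(1) unfolding r(2) by (simp add: field_simps power_divide)
  finally have u: "u x = f \<tau> / r"
    using u_pos[of x] r(1) f_pos[of \<tau>] by (simp add: power2_eq_iff_nonneg)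
  have "P x = y"
    using r(1) f_pos[of \<tau>] \<tau>
    by (auto simp: vec_eq_iff P_def a_def u) (auto simp: x_def r_def)
  then show ?thesis by blast
qed

text \<open>This places the slope \<open>y_k / r\<close> required by \<open>range_P\<close> strictly
  between -1 and 1.\<close>

lemma sqrt_tail:
  assumes "norm y < 1"
  shows "\<bar>y $ k\<bar> < sqrt (1 - (\<Sum>i\<in>UNIV - {k}. (y $ i)\<^sup>2))"
proof -
  have "(norm y)\<^sup>2 = (y $ k)\<^sup>2 + (\<Sum>i\<in>UNIV - {k}. (y $ i)\<^sup>2)"
    by (simp add: norm_sq_sum sum_split_k)
  moreover have "(norm y)\<^sup>2 < 1" using assms by (simp add: abs_square_less_1)
  ultimately show ?thesis by (intro real_less_rsqrt) simp
qed

lemma range_P_even: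
  assumes "\<And>t. f (- t) = f t"
  shows "range P = ball 0 1"
proof -
  have "y \<in> range P" if y: "norm y < 1" for y
  proof -
    define r where "r = sqrt (1 - (\<Sum>i\<in>UNIV - {k}. (y $ i)\<^sup>2))"
    have r: "\<bar>y $ k\<bar> < r" using sqrt_tail[OF y] by (simp add: r_def)
    then have "y $ k / r \<in> range f'"
      unfolding range_f'_even[OF assms] by (auto simp: field_simps abs_less_iff)
    then obtain \<tau> where "f' \<tau> = y $ k / r" by auto
    then show ?thesis using r by (intro range_P[OF y, of \<tau>]) (auto simp: r_def[symmetric])
  qed
  then show ?thesis using norm_P by auto
qed

lemma range_P_pos:
  assumes f': "\<And>t. 0 < f' t"
  shows "range P = ball 0 1 \<inter> {y. 0 < y $ k}"
proof -
  have "y \<in> range P" if y: "norm y < 1" "0 < y $ k" for y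
  proof -
    define r where "r = sqrt (1 - (\<Sum>i\<in>UNIV - {k}. (y $ i)\<^sup>2))"
    have r: "\<bar>y $ k\<bar> < r" using sqrt_tail[OF y(1)] by (simp add: r_def)
    then have "y $ k / r \<in> range f'"
      unfolding range_f'_pos[OF assms] using y(2) by (auto simp: field_simps abs_less_iff)
    then obtain \<tau> where "f' \<tau> = y $ k / r" by auto
    then show ?thesis using r by (intro range_P[OF y(1), of \<tau>]) (auto simp: r_def[symmetric])
  qed
  moreover have "0 < P x $ k" for x
    using f' f_pos u_pos by (simp add: P_k)
  ultimately show ?thesis using norm_P by auto
qed

section \<open>Completeness of the rotational graph\<close>

lemma norm_le_u_g_norm: "norm v \<le> u x * \<kappa> (x $ k) * g_norm x v"
  using norm_le_g_norm[of x v] f_pos[of "x $ k"] s_pos[of "x $ k"] u_pos[of x]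
  by (simp add: sqrt_norm_P \<kappa>_def field_simps)

text \<open>The displacement bound is used twice: for \<open>ln u\<close>, which limits the growth
  of \<open>u\<close> along the curve to a factor \<open>exp (K * R)\<close>, and then for the
  identity, whose Lipschitz constant involves \<open>u\<close>.\<close>

lemma displacement_bound:
  assumes \<gamma>: "\<gamma> \<in> curves_between M (x, u x) (y, u y)" and R: "integral {0..1} (speed \<gamma>) \<le> R"
    and K: "\<And>t. t \<in> {0..1} \<Longrightarrow> \<kappa> (fst (\<gamma> t) $ k) \<le> K"
  shows "norm (y - x) \<le> u x * exp (K * R) * K * integral {0..1} (speed \<gamma>)"
proof -
  have "0 < K" using K[of 0] \<kappa>_pos by (meson atLeastAtMost_iff less_le_trans order_refl zero_le_one)
  have u_le: "u (fst (\<gamma> t)) \<le> u x * exp (K * R)" if t: "t \<in> {0..1}" for t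
  proof -
    have "norm (ln (u (fst (\<gamma> t))) - ln (u (fst (x, u x)))) \<le> K * integral {0..1} (speed \<gamma>)"
    proof (rule displacement_le_length[OF \<gamma>, where F = "\<lambda>z. ln (u z)" and F' = "\<lambda>z v. (P z \<bullet> v) / u z"])
      show "((\<lambda>z. ln (u z)) has_derivative (\<lambda>v. (P z \<bullet> v) / u z)) (at z)" for z
        using u_pos[of z] by (auto intro!: derivative_eq_intros u_deriv simp: divide_inverse mult.commute)
      fix \<tau> :: real and v assume \<tau>: "\<tau> \<in> {0..1}"
      let ?z = "fst (\<gamma> \<tau>)"
      have "\<bar>P ?z \<bullet> v\<bar> \<le> norm (P ?z) * norm v" by (rule Cauchy_Schwarz_ineq2)
      also have "\<dots> \<le> norm v"
        using norm_P[of ?z] by (simp add: mult_left_le_one_le)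
      also have "\<dots> \<le> u ?z * \<kappa> (?z $ k) * g_norm ?z v" by (rule norm_le_u_g_norm)
      also have "\<dots> \<le> u ?z * K * g_norm ?z v"
        using K[OF \<tau>] u_pos[of ?z] g_norm_nonneg by (intro mult_right_mono mult_left_mono) auto
      finally show "norm ((P ?z \<bullet> v) / u ?z) \<le> K * g_norm ?z v"
        using u_pos[of ?z] by (simp add: field_simps)
    qed (use t \<open>0 < K\<close> in auto)
    also have "\<dots> \<le> K * R" using R \<open>0 < K\<close> by simp
    finally have "ln (u (fst (\<gamma> t))) \<le> ln (u x) + K * R" by simp
    then have "exp (ln (u (fst (\<gamma> t)))) \<le> exp (ln (u x) + K * R)" by simp
    then show ?thesis using u_pos by (simp add: exp_add)
  qed
  let ?C = "u x * exp (K * R) * K"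
  have "norm (fst (\<gamma> 1) - fst (x, u x)) \<le> ?C * integral {0..1} (speed \<gamma>)"
  proof (rule displacement_le_length[OF \<gamma>, where F = "\<lambda>z. z" and F' = "\<lambda>z v. v"])
    fix \<tau> :: real and v assume \<tau>: "\<tau> \<in> {0..1}"
    let ?z = "fst (\<gamma> \<tau>)"
    have "norm v \<le> u ?z * \<kappa> (?z $ k) * g_norm ?z v" by (rule norm_le_u_g_norm)
    also have "\<dots> \<le> ?C * g_norm ?z v"
      using K[OF \<tau>] u_le[OF \<tau>] u_pos[of x] u_pos[of ?z] g_norm_nonneg \<kappa>_pos[of "?z $ k"]
      by (intro mult_right_mono mult_mono) auto
    finally show "norm v \<le> ?C * g_norm ?z v" .
  qed (use \<open>0 < K\<close> u_pos[of x] in \<open>auto simp: less_imp_le\<close>)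
  moreover have "fst (\<gamma> 1) = y"
    using \<gamma> by (simp add: curves_between_def pathfinish_def)
  ultimately show ?thesis by simp
qed

text \<open>The left side is the length element of the profile curve \<open>(t, f t)\<close> in the
  Lorentzian plane; motion in the remaining coordinates cannot make the induced length
  smaller.\<close>

lemma s_le_g_norm: "s (x $ k) * \<bar>v $ k\<bar> \<le> g_norm x v"
proof -
  let ?t = "x $ k"
  \<comment> \<open>\<open>w\<close> is the vector formed by \<open>f\<close> and the remaining
    coordinates, with \<open>\<bar>w\<bar> = u\<close>, and \<open>z\<close> is its derivative in
    direction \<open>v\<close>. Thus \<open>P x \<bullet> v\<close> is
    \<open>(w \<bullet> z) / u\<close>, and Cauchy-Schwarz applies.\<close>
  define w z :: "real ^ 'n" where "w = (\<chi> i. if i = k then f ?t else x $ i)"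
    and "z = (\<chi> i. if i = k then f' ?t * v $ k else v $ i)"
  have w: "(norm w)\<^sup>2 = (u x)\<^sup>2"
    by (simp add: norm_sq_sum sum_split_k w_def u_sq)
  have z: "(norm z)\<^sup>2 = (norm v)\<^sup>2 - (s ?t * v $ k)\<^sup>2"
    unfolding power_mult_distrib s_sq
    by (simp add: norm_sq_sum sum_split_k z_def power_mult_distrib algebra_simps)
  have "P x \<bullet> v = (w \<bullet> z) / u x"
    unfolding P_inner by (simp add: sum_split_k a_def inner_vec_def w_def z_def)
  then have "(P x \<bullet> v)\<^sup>2 = (w \<bullet> z)\<^sup>2 / (u x)\<^sup>2" by (simp add: power_divide)
  also have "\<dots> \<le> (norm w)\<^sup>2 * (norm z)\<^sup>2 / (u x)\<^sup>2"
    using Cauchy_Schwarz_ineq[of w z] by (intro divide_right_mono) (auto simp: power2_norm_eq_inner)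
  also have "\<dots> = (norm v)\<^sup>2 - (s ?t * v $ k)\<^sup>2"
    using u_pos[of x] by (simp add: w z)
  finally have "(s ?t * \<bar>v $ k\<bar>)\<^sup>2 \<le> (norm v)\<^sup>2 - (P x \<bullet> v)\<^sup>2"
    by (simp add: power_mult_distrib)
  then show ?thesis
    unfolding g_norm_def by (rule real_le_rsqrt)
qed

text \<open>For \<open>f' > 0\<close> the function \<open>x\<^sub>k - f x\<^sub>k\<close> is 1-Lipschitz, since \<open>1 - f' \<le> sqrt (1 - f'\<^sup>2)\<close>.\<close>

lemma first_coordinate_bound:
  assumes f': "\<And>t. 0 < f' t"
    and \<gamma>: "\<gamma> \<in> curves_between M (x, u x) (y, u y)" and R: "integral {0..1} (speed \<gamma>) \<le> R"
    and t: "t \<in> {0..1}"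
  shows "x $ k - f (x $ k) - R \<le> fst (\<gamma> t) $ k"
proof -
  have "norm ((fst (\<gamma> t) $ k - f (fst (\<gamma> t) $ k)) - (fst (x, u x) $ k - f (fst (x, u x) $ k)))
      \<le> 1 * integral {0..1} (speed \<gamma>)"
  proof (rule displacement_le_length[OF \<gamma>, where F = "\<lambda>z. z $ k - f (z $ k)"
        and F' = "\<lambda>z v. v $ k - f' (z $ k) * v $ k"])
    show "((\<lambda>z :: real ^ 'n. z $ k - f (z $ k)) has_derivative (\<lambda>v. v $ k - f' (z $ k) * v $ k)) (at z)" for z
      by (intro has_derivative_diff nth_deriv f_nth_deriv)
    fix \<tau> :: real and v
    let ?z = "fst (\<gamma> \<tau>)"
    have f'1: "0 < f' (?z $ k)" "f' (?z $ k) < 1" using f' f'_bound[of "?z $ k"] by auto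
    have "norm (v $ k - f' (?z $ k) * v $ k) = (1 - f' (?z $ k)) * \<bar>v $ k\<bar>"
      using f'1 abs_mult[of "1 - f' (?z $ k)" "v $ k"] by (simp add: left_diff_distrib)
    also have "1 - f' (?z $ k) \<le> s (?z $ k)"
      unfolding s_def
    proof (rule real_le_rsqrt)
      have "f' (?z $ k) * f' (?z $ k) \<le> f' (?z $ k) * 1"
        using f'1 by (intro mult_left_mono) auto
      then show "(1 - f' (?z $ k))\<^sup>2 \<le> 1 - (f' (?z $ k))\<^sup>2"
        by (simp add: power2_eq_square algebra_simps)
    qed
    then have "(1 - f' (?z $ k)) * \<bar>v $ k\<bar> \<le> s (?z $ k) * \<bar>v $ k\<bar>"
      by (rule mult_right_mono) simp
    also have "\<dots> \<le> g_norm ?z v" by (rule s_le_g_norm)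
    finally show "norm (v $ k - f' (?z $ k) * v $ k) \<le> 1 * g_norm ?z v" by simp
  qed (use t in auto)
  \<comment> \<open>Positivity of \<open>f\<close> at the point reached allows dropping it from the
    lower bound.\<close>
  then show ?thesis
    using R f_pos[of "fst (\<gamma> t) $ k"] by (simp add: abs_le_iff)
qed

text \<open>\<open>K\<close> may depend on the starting point and on the length bound, because
  \<kappa> has no global bound for \<open>c = 1\<close>.\<close>

lemma complete_if_\<kappa>_bounded:
  assumes "\<And>x R. \<exists>K. \<forall>y. \<forall>\<gamma>\<in>curves_between M (x, u x) (y, u y).
      integral {0..1} (speed \<gamma>) \<le> R \<longrightarrow> (\<forall>t\<in>{0..1}. \<kappa> (fst (\<gamma> t) $ k) \<le> K)"
  shows "complete_riemannian_graph u"
proof -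
  have *: "\<exists>C. \<forall>y. \<forall>\<gamma>\<in>curves_between M (x, u x) (y, u y).
      integral {0..1} (speed \<gamma>) \<le> R \<longrightarrow> norm (y - x) \<le> C * integral {0..1} (speed \<gamma>)" for x R
  proof -
    obtain K where "\<forall>y. \<forall>\<gamma>\<in>curves_between M (x, u x) (y, u y).
      integral {0..1} (speed \<gamma>) \<le> R \<longrightarrow> (\<forall>t\<in>{0..1}. \<kappa> (fst (\<gamma> t) $ k) \<le> K)"
      using assms by blast
    then show ?thesis
      using displacement_bound by (intro exI[of _ "u x * exp (K * R) * K"]) blast
  qed
  show ?thesis
    unfolding complete_riemannian_graph_def
    using C2_u metric_pos complete_if_coercive[OF *] by blast
qed

lemma complete_if_c_less_1:
  assumes "c < 1"
  shows "complete_riemannian_graph u"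
proof -
  obtain m where "0 < m" "\<And>t. m \<le> f t"
    using f_bounded_below[OF assms] by blast
  then have "\<kappa> t \<le> 1 + \<bar>c\<bar> / m ^ CARD('n)" for t by (rule \<kappa>_le)
  then show ?thesis by (intro complete_if_\<kappa>_bounded) blast
qed

lemma complete_increasing:
  assumes f': "\<And>t. 0 < f' t"
  shows "complete_riemannian_graph u"
proof (rule complete_if_\<kappa>_bounded)
  fix x :: "real ^ 'n" and R
  \<comment> \<open>\<open>?T\<close> bounds the \<open>k\<close>-th coordinate from below on curves
    of length at most \<open>R\<close>; \<open>f\<close> increases, so \<open>f ?T\<close> is a
    positive lower bound for \<open>f\<close> along them.\<close>
  let ?T = "x $ k - f (x $ k) - R"
  have "\<kappa> t \<le> 1 + \<bar>c\<bar> / f ?T ^ CARD('n)" if "?T \<le> t" for t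
  proof (rule \<kappa>_le[OF f_pos])
    have "0 \<le> f' ?T * (t - ?T)" using f'[of ?T] that by (intro mult_nonneg_nonneg) auto
    then show "f ?T \<le> f t" using f_tangent_le[OF that] by linarith
  qed
  then show "\<exists>K. \<forall>y. \<forall>\<gamma>\<in>curves_between M (x, u x) (y, u y).
      integral {0..1} (speed \<gamma>) \<le> R \<longrightarrow> (\<forall>t\<in>{0..1}. \<kappa> (fst (\<gamma> t) $ k) \<le> K)"
    using first_coordinate_bound[OF f'] by blast
qed

end

theorem theorem2p3:
  fixes f :: "real \<Rightarrow> real \<Rightarrow> real" and k :: "'n::finite" and u :: "real \<Rightarrow> real ^ 'n \<Rightarrow> real"
  assumes "CARD('n) \<ge> 2"
    and "\<And>c. c \<le> 1 \<Longrightarrow> is_profile CARD('n) c (f c)"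
    and "\<And>c. c \<le> 1 \<Longrightarrow> u c = rotational_height k (f c)"
  shows "(\<forall>c\<le>1. complete_riemannian_graph (u c))
    \<and> (\<forall>c<1. bounded (\<Union>x. principal_curvatures (u c) x))
    \<and> \<not> bounded (\<Union>x. principal_curvatures (u 1) x)
    \<and> (\<forall>c<1. range (gradient (u c)) = ball 0 1)
    \<and> range (gradient (u 1)) = ball 0 1 \<inter> {y. y $ k > 0}"
proof -
  have main: "complete_riemannian_graph (u c)
    \<and> (c < 1 \<longrightarrow> bounded (\<Union>x. principal_curvatures (u c) x) \<and> range (gradient (u c)) = ball 0 1)
    \<and> (c = 1 \<longrightarrow> \<not> bounded (\<Union>x. principal_curvatures (u c) x)
        \<and> range (gradient (u c)) = ball 0 1 \<inter> {y. y $ k > 0})" if c: "c \<le> 1" for c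
  proof -
    \<comment> \<open>The two normalizations are kept as implications, so one interpretation serves
      both \<open>c < 1\<close> and \<open>c = 1\<close>.\<close>
    obtain f' f'' where rot: "rotational_graph TYPE('n) c (f c) f' f''"
      and even: "c < 1 \<Longrightarrow> \<forall>t. f c (- t) = f c t" and inc: "c = 1 \<Longrightarrow> \<forall>t. 0 < f' t"
      using assms(1) assms(2)[OF c] unfolding is_profile_def rotational_graph_def by auto
    interpret G: rotational_graph k c "f c" f' f''
      by (rule rot)
    have u: "u c = G.u" using assms(3)[OF c] by (simp add: G.u_def)
    show ?thesis
    proof (cases "c < 1")
      case True
      then show ?thesis
        using G.complete_if_c_less_1 G.principal_curvatures_bounded G.range_P_even even
        by (simp add: u G.gradient_u)
    next
      case False
      then have "c = 1" using c by simp
      then show ?thesis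
        unfolding u G.gradient_u
        using G.complete_increasing G.principal_curvatures_unbounded G.range_P_pos inc
        by simp
    qed
  qed
  show ?thesis
    using main by auto
qed

end
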